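(* Let $r\ge1$ and let $\{\xi_i\}_{i=1}^{r+1}\subset[0,1]$ be pairwise distinct points with $\xi_1=0$ and $\xi_{r+1}=1$. Let $f_r^\xi:[-\pi,\pi]\to\mathbb{C}^{r\times r}$ be the associated symbol and let $A_n$ be the (normalized) stiffness matrix, of size $nr-1$, of the one-dimensional Laplacian with homogeneous Dirichlet conditions discretized on a uniform mesh of $n$ elements with the basis associated with $\{\xi_i\}$. Then $A_n$ is a principal submatrix of the block Toeplitz matrix $T_n(f_r^\xi)$, and $f_r^\xi$ is both the spectral and the singular value symbol of the matrix-sequence $\{A_n\}_n$, i.e. $$\{A_n\}_n\sim_{\sigma,\lambda}f_r^\xi .$$
   Context: Let $\{\varphi_i\}_{i=1}^{r+1}$ be the basis of $\mathbb{P}_r$ (real univariate polynomials of degree at most $r$) determined by $\varphi_j(\xi_i)=\delta_{i,j}$, and let $A^{\mathrm{loc}}_{i,j}=\int_0^1\varphi_i'(x)\varphi_j'(x)\,\mathrm{d}x$, $i,j=1,\ldots,r+1$. Stiffness matrix: with the local-to-global map $\mathrm{LTG}(i,k)=(k-1)r+i$, $i=1,\ldots,r+1$, $k=1,\ldots,n$, assemble the $(nr+1)\times(nr+1)$ matrix obtained by adding $A^{\mathrm{loc}}_{i,j}$ to the entry $(\mathrm{LTG}(i,k),\mathrm{LTG}(j,k))$ for all $i,j,k$; $A_n$ is obtained from it by deleting the first and the last row and column (homogeneous Dirichlet conditions). Symbol: define $A_\xi\in\mathbb{R}^{(r+1)\times(r+1)}$ by $(A_\xi)_{i,j}=A^{\mathrm{loc}}_{1,1}+A^{\mathrm{loc}}_{r+1,r+1}$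 if $(i,j)=(1,1)$ or $(r+1,r+1)$, and $(A_\xi)_{i,j}=A^{\mathrm{loc}}_{i,j}$ otherwise. Let $\alpha_\xi$ be the leading $r\times r$ block of $A_\xi$, let $\widetilde\beta_\xi\in\mathbb{R}^{1\times r}$ be the first $r$ entries of the last row of $A_\xi$, and let $\beta_\xi\in\mathbb{R}^{r\times r}$ have first row $\widetilde\beta_\xi$ and all other rows zero. Then $f_r^\xi(\theta)=\alpha_\xi+\beta_\xi e^{\mathrm{i}\theta}+\beta_\xi^Te^{-\mathrm{i}\theta}$. Toeplitz matrices: for $f\in L^1([-\pi,\pi])$ with values in $\mathbb{C}^{r\times r}$ and Fourier coefficients $\hat f_k=\frac1{2\pi}\int_{-\pi}^{\pi}f(\theta)e^{-\mathrm{i}k\theta}\,\mathrm{d}\theta$, $T_n(f)=[\hat f_{i-j}]_{i,j=1}^n\in\mathbb{C}^{nr\times nr}$. Distribution: let $\{A_n\}_n$ be a sequence of matrices with $A_n$ of size $d_n\to\infty$ strictly increasing, and let $f:D\subset\mathbb{R}^t\to\mathbb{C}^{r\times r}$ be measurable with $0<\mu_t(D)<\infty$ ($\mu_t$ Lebesgue measure). Write $\{A_n\}_n\sim_\sigma f$ if for all $F\in C_c(\mathbb{R})$ (continuous complex-valued with bounded support), $\lim_{n\to\infty}\frac1{d_n}\sum_{i=1}^{d_n}F(\sigma_i(A_n))=\frac1{\mu_t(D)}\int_D\frac1r\sum_{i=1}^rF(\sigma_i(f(\mathbf{x})))\,\mathrm{d}\mathbf{x}$, where $\sigma_i$ are singular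 values; write $\{A_n\}_n\sim_\lambda f$ if the same holds with eigenvalues $\lambda_i$ in place of singular values and all $F\in C_c(\mathbb{C})$. $\{A_n\}_n\sim_{\sigma,\lambda}f$ means both. *)

theory Defs
  imports
    "HOL-Analysis.Analysis"
    "HOL-Computational_Algebra.Computational_Algebra"
    "Jordan_Normal_Form.Schur_Decomposition"
    "Jordan_Normal_Form.DL_Submatrix"
begin

section \<open>Nodal basis and local stiffness matrix\<close>

text \<open>
  Nodes, basis functions and local stiffness entries carry the indices $1, \dots, r+1$; matrices
  of type \<^typ>\<open>'a mat\<close> are indexed from 0.
\<close>

definition nodal_poly :: "nat \<Rightarrow> (nat \<Rightarrow> real) \<Rightarrow> nat \<Rightarrow> real poly" where
  "nodal_poly r \<xi> j =
     (THE p. degree p \<le> r \<and> (\<forall>i\<in>{1..r+1}. poly p (\<xi> i) = (if i = j then 1 else 0)))"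

lemma nodal_poly_ex1:
  assumes inj: "inj_on \<xi> {1..r+1}" and j: "j \<in> {1..r+1}"
  shows "\<exists>!p::real poly. degree p \<le> r \<and> (\<forall>i\<in>{1..r+1}. poly p (\<xi> i) = (if i = j then 1 else 0))"
proof -
  let ?S = "{1..r+1} - {j}"
  let ?q = "\<Prod>i\<in>?S. [:- \<xi> i, 1:]"
  let ?c = "poly ?q (\<xi> j)"
  have c: "?c \<noteq> 0"
    using inj j by (auto simp: poly_prod inj_on_def)
  have "degree ?q \<le> (\<Sum>i\<in>?S. degree [:- \<xi> i, 1:])"
    using degree_prod_sum_le[of ?S "\<lambda>i. [:- \<xi> i, 1:]"] by (simp add: o_def)
  also have "\<dots> = r"
    using j by simp
  finally have deg: "degree (Polynomial.smult (1 / ?c) ?q) \<le> r"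
    using degree_smult_le order_trans by blast
  have vals: "poly (Polynomial.smult (1 / ?c) ?q) (\<xi> i) = (if i = j then 1 else 0)"
    if "i \<in> {1..r+1}" for i
  proof (cases "i = j")
    case False
    then have "poly ?q (\<xi> i) = 0"
      using that unfolding poly_prod by (intro prod_zero) auto
    then show ?thesis
      using False by simp
  qed (use c in simp)
  show ?thesis
  proof (rule ex_ex1I)
    show "\<exists>p::real poly. degree p \<le> r \<and>
        (\<forall>i\<in>{1..r+1}. poly p (\<xi> i) = (if i = j then 1 else 0))"
      using deg vals by blast
  next
    fix p q :: "real poly"
    assume p: "degree p \<le> r \<and> (\<forall>i\<in>{1..r+1}. poly p (\<xi> i) = (if i = j then 1 else 0))"
      and q: "degree q \<le> r \<and> (\<forall>i\<in>{1..r+1}. poly q (\<xi> i) = (if i = j then 1 else 0))"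
    show "p = q"
    proof (rule ccontr)
      assume "p \<noteq> q"
      then have nz: "p - q \<noteq> 0" by simp
      have "\<xi> ` {1..r+1} \<subseteq> {x. poly (p - q) x = 0}"
        using p q by auto
      then have "card (\<xi> ` {1..r+1}) \<le> degree (p - q)"
        using poly_roots_finite[OF nz] card_poly_roots_bound[OF nz]
        by (meson card_mono order_trans)
      moreover have "card (\<xi> ` {1..r+1}) = r + 1"
        using card_image[OF inj] by simp
      moreover have "degree (p - q) \<le> r"
        using p q by (simp add: degree_diff_le)
      ultimately show False by simp
    qed
  qed
qed

definition A_loc :: "nat \<Rightarrow> (nat \<Rightarrow> real) \<Rightarrow> nat \<Rightarrow> nat \<Rightarrow> real" where
  "A_loc r \<xi> i j =
     integral {0..1} (\<lambda>x. poly (pderiv (nodal_poly r \<xi> i)) x * poly (pderiv (nodal_poly r \<xi> j)) x)"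

section \<open>Stiffness matrix\<close>

definition LTG :: "nat \<Rightarrow> nat \<Rightarrow> nat \<Rightarrow> nat" where
  "LTG r i k = (k - 1) * r + i"

definition assembled_matrix :: "nat \<Rightarrow> (nat \<Rightarrow> real) \<Rightarrow> nat \<Rightarrow> real mat" where
  "assembled_matrix r \<xi> n = mat (n * r + 1) (n * r + 1) (\<lambda>(p, q).
     \<Sum>k\<in>{1..n}. \<Sum>i\<in>{1..r+1}. \<Sum>j\<in>{1..r+1}.
       if LTG r i k = p + 1 \<and> LTG r j k = q + 1 then A_loc r \<xi> i j else 0)"

definition stiffness_matrix :: "nat \<Rightarrow> (nat \<Rightarrow> real) \<Rightarrow> nat \<Rightarrow> complex mat" where
  "stiffness_matrix r \<xi> n =
     map_mat complex_of_real (mat_delete (mat_delete (assembled_matrix r \<xi> n) (n * r) (n * r)) 0 0)"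

section \<open>Symbol\<close>

definition A_sym :: "nat \<Rightarrow> (nat \<Rightarrow> real) \<Rightarrow> real mat" where
  "A_sym r \<xi> = mat (r + 1) (r + 1) (\<lambda>(i, j).
     if (i, j) = (0, 0) \<or> (i, j) = (r, r) then A_loc r \<xi> 1 1 + A_loc r \<xi> (r + 1) (r + 1)
     else A_loc r \<xi> (i + 1) (j + 1))"

definition alpha_sym :: "nat \<Rightarrow> (nat \<Rightarrow> real) \<Rightarrow> real mat" where
  "alpha_sym r \<xi> = mat r r (\<lambda>(i, j). A_sym r \<xi> $$ (i, j))"

definition beta_sym :: "nat \<Rightarrow> (nat \<Rightarrow> real) \<Rightarrow> real mat" where
  "beta_sym r \<xi> = mat r r (\<lambda>(i, j). if i = 0 then A_sym r \<xi> $$ (r, j) else 0)"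

definition fem_symbol :: "nat \<Rightarrow> (nat \<Rightarrow> real) \<Rightarrow> real \<Rightarrow> complex mat" where
  "fem_symbol r \<xi> \<theta> =
     map_mat complex_of_real (alpha_sym r \<xi>)
     + exp (\<i> * complex_of_real \<theta>) \<cdot>\<^sub>m map_mat complex_of_real (beta_sym r \<xi>)
     + exp (- \<i> * complex_of_real \<theta>) \<cdot>\<^sub>m map_mat complex_of_real (transpose_mat (beta_sym r \<xi>))"

section \<open>Block Toeplitz matrices\<close>

definition fourier_coeff :: "nat \<Rightarrow> (real \<Rightarrow> complex mat) \<Rightarrow> int \<Rightarrow> complex mat" where
  "fourier_coeff r f k = mat r r (\<lambda>(a, b).
     complex_of_real (1 / (2 * pi)) *
     (LINT \<theta>:{-pi..pi}|lebesgue. (f \<theta> $$ (a, b)) * exp (- \<i> * of_int k * complex_of_real \<theta>)))"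

definition block_toeplitz :: "nat \<Rightarrow> nat \<Rightarrow> (real \<Rightarrow> complex mat) \<Rightarrow> complex mat" where
  "block_toeplitz r n f = mat (n * r) (n * r) (\<lambda>(p, q).
     fourier_coeff r f (int (p div r) - int (q div r)) $$ (p mod r, q mod r))"

definition principal_submatrix :: "'a mat \<Rightarrow> 'a mat \<Rightarrow> bool" where
  "principal_submatrix A B \<longleftrightarrow> square_mat B \<and> (\<exists>I. I \<subseteq> {..<dim_row B} \<and> A = submatrix B I I)"

section \<open>Asymptotic distributions\<close>

text \<open>Eigenvalues and singular values are multisets, i.e. listed with multiplicity.\<close>

definition eigvals :: "complex mat \<Rightarrow> complex multiset" where
  "eigvals A = proots (char_poly A)"

definition singvals :: "complex mat \<Rightarrow> real multiset" where
  "singvals A = image_mset (\<lambda>z. sqrt (Re z)) (eigvals (mat_adjoint A * A))"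

definition continuous_bounded_support :: "('a::real_normed_vector \<Rightarrow> complex) \<Rightarrow> bool" where
  "continuous_bounded_support F \<longleftrightarrow> continuous_on UNIV F \<and> bounded {x. F x \<noteq> 0}"

text \<open>Sequences are indexed by $n \ge 1$; the matrix with index 0 plays no role.\<close>

definition matrix_sequence :: "(nat \<Rightarrow> complex mat) \<Rightarrow> bool" where
  "matrix_sequence A \<longleftrightarrow>
     (\<forall>n\<ge>1. square_mat (A n)) \<and> strict_mono_on {1..} (\<lambda>n. dim_row (A n))"

definition matrix_function ::
    "nat \<Rightarrow> 'a::euclidean_space set \<Rightarrow> ('a \<Rightarrow> complex mat) \<Rightarrow> bool" where
  "matrix_function r D f \<longleftrightarrow>
     0 < r \<and> D \<in> lmeasurable \<and> 0 < measure lebesgue D \<and>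
     (\<forall>x\<in>D. f x \<in> carrier_mat r r) \<and>
     (\<forall>i<r. \<forall>j<r. (\<lambda>x. f x $$ (i, j)) \<in> borel_measurable (lebesgue_on D))"

definition spectral_symbol ::
    "(nat \<Rightarrow> complex mat) \<Rightarrow> nat \<Rightarrow> 'a::euclidean_space set \<Rightarrow> ('a \<Rightarrow> complex mat) \<Rightarrow> bool" where
  "spectral_symbol A r D f \<longleftrightarrow> matrix_sequence A \<and> matrix_function r D f \<and>
     (\<forall>F :: complex \<Rightarrow> complex. continuous_bounded_support F \<longrightarrow>
       (\<lambda>n. (\<Sum>z\<in>#eigvals (A n). F z) / of_nat (dim_row (A n))) \<longlonglongrightarrow>
       complex_of_real (1 / measure lebesgue D) *
         (LINT x:D|lebesgue. (\<Sum>z\<in>#eigvals (f x). F z) / of_nat r))"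

definition singular_value_symbol ::
    "(nat \<Rightarrow> complex mat) \<Rightarrow> nat \<Rightarrow> 'a::euclidean_space set \<Rightarrow> ('a \<Rightarrow> complex mat) \<Rightarrow> bool" where
  "singular_value_symbol A r D f \<longleftrightarrow> matrix_sequence A \<and> matrix_function r D f \<and>
     (\<forall>F :: real \<Rightarrow> complex. continuous_bounded_support F \<longrightarrow>
       (\<lambda>n. (\<Sum>s\<in>#singvals (A n). F s) / of_nat (dim_row (A n))) \<longlonglongrightarrow>
       complex_of_real (1 / measure lebesgue D) *
         (LINT x:D|lebesgue. (\<Sum>s\<in>#singvals (f x). F s) / of_nat r))"

end

theory Submission
  imports Defs "HOL-Real_Asymp.Real_Asymp"
begin

text \<open>
  The stiffness matrix and the values of the symbol are Hermitian, so all
  eigenvalues are real, and all of them lie in one bounded interval because row sums are bounded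
  uniformly. On such an interval every continuous test function is a uniform limit of polynomials,
  so it suffices to compare moments (\<open>moment_convergence_imp_distribution\<close>). The \<open>k\<close>-th moment is
  the normalised trace of the \<open>k\<close>-th power (\<open>power_sum_eigvals\<close>).

  The traces are compared through the doubly infinite block Toeplitz matrix of the symbol \<open>f\<close>.
  Without a boundary, its \<open>k\<close>-th power is the block Toeplitz matrix of \<open>f\<^sup>k\<close>
  (\<open>laurent_Suc\<close>), and the trace of one diagonal block of that power is by definition the mean over
  \<open>[-\<pi>, \<pi>]\<close> of the trace of \<open>f\<^sup>k\<close>. Because the matrix is block tridiagonal, the \<open>k\<close>-th power
  of a finite section agrees with it except within \<open>k\<close> blocks of the two ends
  (\<open>truncation_pow_interior\<close>). Hence the trace of the \<open>k\<close>-th power of the section is \<open>n\<close> times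
  that mean up to a bounded error (\<open>truncation_trace_bound\<close>), which disappears after division by
  the dimension.

  Singular values of a Hermitian matrix are the moduli of its eigenvalues, so the singular value
  distribution follows from the eigenvalue distribution by composing test functions with the
  modulus. It remains to see that assembling the elements and deleting the boundary nodes produces
  exactly such a section (\<open>assembled_entry\<close>): the nodes fall into blocks of \<open>r\<close>, and the only
  node shared by two elements is what couples adjacent blocks. The same computation exhibits the
  stiffness matrix as the principal submatrix of the block Toeplitz matrix to all indices but the
  first.
\<close>

(* Only entries of vectors of variable dimension are written with $ below. *)
unbundle no vec_syntax
no_notation fps_nth (infixl \<open>$\<close> 75)

section \<open>Eigenvalues, traces of powers and Hermitian matrices\<close>

lemma eigvals_char_poly:
  assumes "char_poly A = (\<Prod>a\<leftarrow>es. [:- a, 1:])"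
  shows "eigvals A = mset es"
proof -
  have "proots (\<Prod>a\<leftarrow>es. [:- a, 1:]) = mset es" for es :: "complex list"
  proof (induction es)
    case (Cons a es)
    have "(\<Prod>a\<leftarrow>es. [:- a, 1:]) \<noteq> 0" by (auto simp: prod_list_zero_iff)
    with Cons show ?case by (simp add: proots_mult del: mult_pCons_left)
  qed simp
  then show ?thesis by (simp add: eigvals_def assms)
qed

lemma upper_triangular_mult:
  fixes A B :: "'a::comm_semiring_1 mat"
  assumes A: "A \<in> carrier_mat n n" and B: "B \<in> carrier_mat n n"
    and uA: "upper_triangular A" and uB: "upper_triangular B"
  shows "upper_triangular (A * B)" and "i < n \<Longrightarrow> (A * B) $$ (i, i) = A $$ (i, i) * B $$ (i, i)"
proof -
  have entry: "(A * B) $$ (i, j) = (\<Sum>s<n. A $$ (i, s) * B $$ (s, j))" if "i < n" "j < n" for i j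
    using that A B by (simp add: scalar_prod_def lessThan_atLeast0)
  have lowA: "A $$ (i, j) = 0" if "i < n" "j < i" for i j
    using upper_triangularD[OF uA, of j i] that A by auto
  have lowB: "B $$ (i, j) = 0" if "i < n" "j < i" for i j
    using upper_triangularD[OF uB, of j i] that B by auto
  show "upper_triangular (A * B)"
  proof
    fix i j assume ij: "j < i" "i < dim_row (A * B)"
    have "(\<Sum>s<n. A $$ (i, s) * B $$ (s, j)) = 0"
    proof (rule sum.neutral, safe)
      fix s assume "s < n"
      with ij A show "A $$ (i, s) * B $$ (s, j) = 0"
        by (cases "s < i") (simp_all add: lowA lowB)
    qed
    with ij A show "(A * B) $$ (i, j) = 0" by (simp add: entry)
  qed
  show "(A * B) $$ (i, i) = A $$ (i, i) * B $$ (i, i)" if i: "i < n"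
  proof -
    have "(A * B) $$ (i, i) = (\<Sum>s<n. if s = i then A $$ (i, i) * B $$ (i, i) else 0)"
      unfolding entry[OF i i]
      by (rule sum.cong) (use i in \<open>auto simp: lowA lowB not_less_iff_gr_or_eq dest: nat_neq_iff[THEN iffD1]\<close>)
    then show ?thesis using i by simp
  qed
qed

text \<open>
  Together with Schur triangularization, this makes the diagonal of the triangular form carry
  the eigenvalues of every power of a matrix.
\<close>

lemma upper_triangular_pow:
  fixes A :: "'a::comm_semiring_1 mat"
  assumes A: "A \<in> carrier_mat n n" and u: "upper_triangular A"
  shows "upper_triangular (A ^\<^sub>m k) \<and> (\<forall>i<n. (A ^\<^sub>m k) $$ (i, i) = (A $$ (i, i)) ^ k)"
proof (induction k)
  case (Suc k)
  have "A ^\<^sub>m k \<in> carrier_mat n n" using A by simp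
  from upper_triangular_mult[OF this A conjunct1[OF Suc] u] Suc show ?case
    by (simp add: mult.commute)
qed (use A in auto)

lemma sum_diag_mult_commute:
  fixes A B :: "'a::comm_semiring_1 mat"
  assumes "A \<in> carrier_mat n m" "B \<in> carrier_mat m n"
  shows "(\<Sum>i<n. (A * B) $$ (i, i)) = (\<Sum>i<m. (B * A) $$ (i, i))"
proof -
  have "(\<Sum>i<n. (A * B) $$ (i, i)) = (\<Sum>i<n. \<Sum>s<m. A $$ (i, s) * B $$ (s, i))"
    by (rule sum.cong) (use assms in \<open>auto simp: scalar_prod_def lessThan_atLeast0\<close>)
  also have "\<dots> = (\<Sum>s<m. \<Sum>i<n. B $$ (s, i) * A $$ (i, s))"
    by (subst sum.swap) (simp add: mult.commute)
  also have "\<dots> = (\<Sum>i<m. (B * A) $$ (i, i))"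
    by (rule sum.cong) (use assms in \<open>auto simp: scalar_prod_def lessThan_atLeast0\<close>)
  finally show ?thesis .
qed

lemma complex_schur_eigvals:
  fixes A :: "complex mat"
  assumes A: "A \<in> carrier_mat n n"
  obtains B P Q where "B \<in> carrier_mat n n" "upper_triangular B" "similar_mat_wit A B P Q"
    "eigvals A = mset (diag_mat B)"
proof -
  from char_poly_factorized[OF A] obtain es where
    cA: "char_poly A = (\<Prod>a\<leftarrow>es. [:- a, 1:])" by auto
  obtain B P Q where "schur_decomposition A es = (B, P, Q)"
    by (cases "schur_decomposition A es") auto
  from schur_decomposition[OF A cA this]
  have w: "similar_mat_wit A B P Q" and u: "upper_triangular B" and d: "diag_mat B = es" by auto
  from similar_mat_witD2[OF A w] have "B \<in> carrier_mat n n" by auto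
  then show ?thesis using that u w d eigvals_char_poly[OF cA] by metis
qed

lemma eigvals_pow:
  fixes A :: "complex mat"
  assumes A: "A \<in> carrier_mat n n"
  shows "eigvals (A ^\<^sub>m k) = image_mset (\<lambda>z. z ^ k) (eigvals A)"
proof -
  obtain B P Q where B: "B \<in> carrier_mat n n" and u: "upper_triangular B"
    and w: "similar_mat_wit A B P Q" and e: "eigvals A = mset (diag_mat B)"
    using complex_schur_eigvals[OF A] .
  have Bk: "B ^\<^sub>m k \<in> carrier_mat n n" using B by simp
  have "char_poly (A ^\<^sub>m k) = char_poly (B ^\<^sub>m k)"
    by (rule char_poly_similar) (use similar_mat_wit_pow[OF w] in \<open>auto simp: similar_mat_def\<close>)
  also have "\<dots> = (\<Prod>a\<leftarrow>diag_mat (B ^\<^sub>m k). [:- a, 1:])"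
    using char_poly_upper_triangular[OF Bk] upper_triangular_pow[OF B u] by blast
  finally have "eigvals (A ^\<^sub>m k) = mset (diag_mat (B ^\<^sub>m k))"
    by (rule eigvals_char_poly)
  also have "diag_mat (B ^\<^sub>m k) = map (\<lambda>z. z ^ k) (diag_mat B)"
    unfolding diag_mat_def using Bk B upper_triangular_pow[OF B u, of k] by auto
  finally show ?thesis by (simp add: e)
qed

text \<open>
  The bridge between spectra and entries: power sums of eigenvalues are diagonal sums of matrix
  powers, which are polynomials in the entries and can therefore be compared entry by entry.
\<close>

lemma power_sum_eigvals:
  fixes A :: "complex mat"
  assumes A: "A \<in> carrier_mat n n"
  shows "(\<Sum>z\<in>#eigvals A. z ^ k) = (\<Sum>i<n. (A ^\<^sub>m k) $$ (i, i))"
proof -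
  obtain B P Q where B: "B \<in> carrier_mat n n" and u: "upper_triangular B"
    and w: "similar_mat_wit A B P Q" and e: "eigvals A = mset (diag_mat B)"
    using complex_schur_eigvals[OF A] .
  from similar_mat_witD2[OF A w] have PQ: "P \<in> carrier_mat n n" "Q \<in> carrier_mat n n"
    and QP: "Q * P = 1\<^sub>m n" by auto
  have Bk: "B ^\<^sub>m k \<in> carrier_mat n n" using B by simp
  have "(\<Sum>i<n. (A ^\<^sub>m k) $$ (i, i)) = (\<Sum>i<n. (P * B ^\<^sub>m k * Q) $$ (i, i))"
    using similar_mat_wit_pow_id[OF w] by simp
  also have "\<dots> = (\<Sum>i<n. (Q * (P * B ^\<^sub>m k)) $$ (i, i))"
    using PQ Bk by (intro sum_diag_mult_commute) auto
  also have "Q * (P * B ^\<^sub>m k) = B ^\<^sub>m k"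
    unfolding assoc_mult_mat[OF PQ(2) PQ(1) Bk, symmetric] QP by (rule left_mult_one_mat[OF Bk])
  also have "(\<Sum>i<n. (B ^\<^sub>m k) $$ (i, i)) = (\<Sum>i<n. (B $$ (i, i)) ^ k)"
    using upper_triangular_pow[OF B u] by simp
  also have "\<dots> = sum_list (map (\<lambda>z. z ^ k) (diag_mat B))"
    using B by (simp add: diag_mat_def o_def interv_sum_list_conv_sum_set_nat lessThan_atLeast0)
  also have "\<dots> = (\<Sum>z\<in>#eigvals A. z ^ k)"
    unfolding e mset_map[symmetric] sum_mset_sum_list ..
  finally show ?thesis by simp
qed

lemma size_eigvals:
  assumes "A \<in> carrier_mat n n"
  shows "size (eigvals A) = n"
  unfolding eigvals_def size_proots_complex using degree_monic_char_poly[OF assms] by blast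

lemma eigvals_eigenvector:
  assumes A: "A \<in> carrier_mat n n" and z: "z \<in># eigvals A"
  obtains v where "v \<in> carrier_vec n" "v \<noteq> 0\<^sub>v n" "A *\<^sub>v v = z \<cdot>\<^sub>v v"
proof -
  have "char_poly A \<noteq> 0" using degree_monic_char_poly[OF A] by auto
  then have "poly (char_poly A) z = 0" using z by (simp add: eigvals_def)
  then have "eigenvalue A z" using eigenvalue_root_char_poly[OF A] by simp
  then show ?thesis using that A unfolding eigenvalue_def eigenvector_def by auto
qed

text \<open>
  Read the eigenvector equation in a row where the eigenvector has an entry of largest modulus.
\<close>

lemma norm_eigvals_le_row_sum:
  assumes A: "A \<in> carrier_mat n n" and z: "z \<in># eigvals A"
    and M: "\<And>i. i < n \<Longrightarrow> (\<Sum>j<n. norm (A $$ (i, j))) \<le> M"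
  shows "norm z \<le> M"
proof -
  obtain v where v: "v \<in> carrier_vec n" "v \<noteq> 0\<^sub>v n" "A *\<^sub>v v = z \<cdot>\<^sub>v v"
    using eigvals_eigenvector[OF A z] .
  obtain j where j: "j < n" "v $ j \<noteq> 0" using v(1,2) by (metis carrier_vecD eq_vecI index_zero_vec)
  define m where "m = Max ((\<lambda>i. norm (v $ i)) ` {..<n})"
  have "m \<in> (\<lambda>i. norm (v $ i)) ` {..<n}"
    unfolding m_def by (rule Max_in) (use j in auto)
  then obtain i where i: "i < n" and mi: "m = norm (v $ i)" by auto
  have le: "norm (v $ s) \<le> m" if "s < n" for s
    unfolding m_def by (rule Max_ge) (use that in auto)
  have m0: "m > 0" using le[OF j(1)] j(2) by (smt (verit) zero_less_norm_iff)
  have "z * v $ i = (A *\<^sub>v v) $ i" using v i by simp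
  also have "\<dots> = (\<Sum>s<n. A $$ (i, s) * v $ s)"
    using A v(1) i by (auto simp: scalar_prod_def lessThan_atLeast0)
  finally have "norm z * m = norm (\<Sum>s<n. A $$ (i, s) * v $ s)"
    by (metis mi norm_mult)
  also have "\<dots> \<le> (\<Sum>s<n. norm (A $$ (i, s)) * m)"
    by (rule sum_norm_le) (use le in \<open>auto simp: norm_mult intro!: mult_left_mono\<close>)
  also have "\<dots> \<le> M * m"
    using M[OF i] m0 by (simp add: sum_distrib_right[symmetric])
  finally show ?thesis using m0 by simp
qed

lemma row_sum_pow_le:
  fixes A :: "complex mat"
  assumes A: "A \<in> carrier_mat n n" and i: "i < n"
    and M: "\<And>i. i < n \<Longrightarrow> (\<Sum>j<n. norm (A $$ (i, j))) \<le> M"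
  shows "(\<Sum>j<n. norm ((A ^\<^sub>m k) $$ (i, j))) \<le> M ^ k"
proof (induction k)
  case 0
  have "(\<Sum>j<n. norm ((A ^\<^sub>m 0) $$ (i, j))) = (\<Sum>j<n. if j = i then 1 else 0)"
    by (rule sum.cong) (use A i in auto)
  then show ?case using i by simp
next
  case (Suc k)
  let ?B = "A ^\<^sub>m k"
  have B: "?B \<in> carrier_mat n n" using A by simp
  have M0: "0 \<le> M" by (rule order_trans[OF _ M[OF i]]) (simp add: sum_nonneg)
  have "(\<Sum>j<n. norm ((A ^\<^sub>m Suc k) $$ (i, j))) = (\<Sum>j<n. norm (\<Sum>s<n. ?B $$ (i, s) * A $$ (s, j)))"
    by (rule sum.cong) (use A B i in \<open>auto simp: scalar_prod_def lessThan_atLeast0\<close>)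
  also have "\<dots> \<le> (\<Sum>j<n. \<Sum>s<n. norm (?B $$ (i, s)) * norm (A $$ (s, j)))"
    by (intro sum_mono order_trans[OF norm_sum]) (simp add: norm_mult)
  also have "\<dots> = (\<Sum>s<n. norm (?B $$ (i, s)) * (\<Sum>j<n. norm (A $$ (s, j))))"
    by (subst sum.swap) (simp add: sum_distrib_left)
  also have "\<dots> \<le> (\<Sum>s<n. norm (?B $$ (i, s)) * M)"
    by (intro sum_mono mult_left_mono M) auto
  also have "\<dots> \<le> M ^ k * M"
    unfolding sum_distrib_right[symmetric] by (rule mult_right_mono[OF Suc M0])
  finally show ?case by (simp add: mult.commute)
qed

lemma mat_adjoint_eqI:
  assumes A: "A \<in> carrier_mat n n"
    and "\<And>i j. i < n \<Longrightarrow> j < n \<Longrightarrow> A $$ (j, i) = cnj (A $$ (i, j))"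
  shows "mat_adjoint A = A"
proof (rule eq_matI)
  fix i j assume "i < dim_row A" "j < dim_col A"
  then show "mat_adjoint A $$ (i, j) = A $$ (i, j)"
    using A assms(2)[of j i] unfolding mat_adjoint_def by (simp add: mat_of_rows_def)
qed (use A in \<open>auto simp: mat_adjoint_def\<close>)

text \<open>
  For an eigenvector \<open>v\<close> the quadratic form \<open>q = v\<^sup>* A v\<close> equals \<open>z\<close> times the
  positive number \<open>w = v\<^sup>* v\<close>, and hermitian symmetry makes \<open>q\<close> its own conjugate.
\<close>

lemma eigvals_hermitian_real:
  assumes A: "A \<in> carrier_mat n n" and z: "z \<in># eigvals A"
    and herm: "\<And>i j. i < n \<Longrightarrow> j < n \<Longrightarrow> A $$ (j, i) = cnj (A $$ (i, j))"
  shows "z \<in> \<real>"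
proof -
  obtain v where v: "v \<in> carrier_vec n" "v \<noteq> 0\<^sub>v n" "A *\<^sub>v v = z \<cdot>\<^sub>v v"
    using eigvals_eigenvector[OF A z] .
  obtain j where j: "j < n" "v $ j \<noteq> 0" using v(1,2) by (metis carrier_vecD eq_vecI index_zero_vec)
  have row: "z * v $ i = (\<Sum>s<n. A $$ (i, s) * v $ s)" if "i < n" for i
  proof -
    have "z * v $ i = (A *\<^sub>v v) $ i" using v that by simp
    also have "\<dots> = (\<Sum>s<n. A $$ (i, s) * v $ s)"
      using A v(1) that by (auto simp: scalar_prod_def lessThan_atLeast0)
    finally show ?thesis .
  qed
  define w where "w = (\<Sum>i<n. (norm (v $ i))\<^sup>2)"
  have w: "w > 0" unfolding w_def
    by (rule sum_pos2[of _ j]) (use j in auto)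
  define q where "q = (\<Sum>i<n. \<Sum>s<n. cnj (v $ i) * A $$ (i, s) * v $ s)"
  have "z * of_real w = (\<Sum>i<n. cnj (v $ i) * (z * v $ i))"
    unfolding w_def of_real_sum
    by (simp add: sum_distrib_left mult_ac flip: of_real_power complex_norm_square)
  also have "\<dots> = q" unfolding q_def
    by (rule sum.cong) (simp_all add: row sum_distrib_left mult_ac)
  finally have zq: "z * of_real w = q" .
  have cnjA: "cnj (A $$ (i, s)) = A $$ (s, i)" if "i < n" "s < n" for i s
    using herm[OF that] by simp
  have "cnj q = (\<Sum>i<n. \<Sum>s<n. cnj (v $ s) * A $$ (s, i) * v $ i)"
    unfolding q_def cnj_sum
    by (intro sum.cong refl) (simp add: mult_ac cnjA)
  also have "\<dots> = q" unfolding q_def by (rule sum.swap)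
  finally have "cnj (z * of_real w) = z * of_real w" using zq by simp
  then have "cnj z = z" using w by simp
  then show ?thesis by (simp add: Reals_cnj_iff)
qed

text \<open>
  Here \<open>A\<^sup>* A = A\<^sup>2\<close>, and the square root of the square of a real eigenvalue is its modulus.
  This reduces singular value distributions of Hermitian sequences to eigenvalue distributions.
\<close>

lemma singvals_hermitian:
  assumes A: "A \<in> carrier_mat n n"
    and herm: "\<And>i j. i < n \<Longrightarrow> j < n \<Longrightarrow> A $$ (j, i) = cnj (A $$ (i, j))"
  shows "singvals A = image_mset norm (eigvals A)"
proof -
  have "mat_adjoint A * A = A ^\<^sub>m 2"
    using A mat_adjoint_eqI[OF A herm] by (simp add: numeral_2_eq_2)
  then have "singvals A = image_mset (\<lambda>z. sqrt (Re (z ^ 2))) (eigvals A)"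
    by (simp add: singvals_def eigvals_pow[OF A] multiset.map_comp o_def)
  also have "\<dots> = image_mset norm (eigvals A)"
  proof (rule image_mset_cong)
    fix z assume "z \<in># eigvals A"
    then have "z \<in> \<real>" using eigvals_hermitian_real[OF A] herm by blast
    then show "sqrt (Re (z ^ 2)) = norm z" by (auto elim!: Reals_cases simp flip: of_real_power)
  qed
  finally show ?thesis .
qed

section \<open>From convergence of moments to convergence of distributions\<close>

lemma set_lebesgue_integral_continuous:
  fixes h :: "real \<Rightarrow> 'a::euclidean_space"
  assumes "continuous_on {a..b} h"
  shows "(LINT x:{a..b}|lebesgue. h x) = integral {a..b} h"
  using set_lebesgue_integral_eq_integral(2) absolutely_integrable_continuous_real[OF assms] .

lemma approx_by_complex_polynomial:
  fixes G :: "real \<Rightarrow> complex"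
  assumes G: "continuous_on {a..b} G" and e: "0 < e"
  obtains c N where "\<And>x. x \<in> {a..b} \<Longrightarrow> norm (G x - (\<Sum>i\<le>N. c i * of_real x ^ i)) < e"
proof -
  obtain g where g: "polynomial_function g" "\<And>x. x \<in> {a..b} \<Longrightarrow> norm (G x - g x) < e"
    using Stone_Weierstrass_polynomial_function[OF compact_Icc G e] by blast
  have "real_polynomial_function (Re \<circ> g)" "real_polynomial_function (Im \<circ> g)"
    using g(1) bounded_linear_Re bounded_linear_Im unfolding polynomial_function_def by auto
  then obtain p m q l where
    p: "Re \<circ> g = (\<lambda>x. \<Sum>i\<le>m. p i * x ^ i)" and q: "Im \<circ> g = (\<lambda>x. \<Sum>i\<le>l. q i * x ^ i)"
    unfolding real_polynomial_function_iff_sum by blast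
  define N where "N = max m l"
  define c where "c i = Complex (if i \<le> m then p i else 0) (if i \<le> l then q i else 0)" for i
  have "g x = (\<Sum>i\<le>N. c i * of_real x ^ i)" for x
  proof (rule complex_eqI)
    have "Re (g x) = (\<Sum>i\<le>m. p i * x ^ i)" using fun_cong[OF p, of x] by simp
    also have "\<dots> = (\<Sum>i\<le>N. Re (c i) * x ^ i)"
      by (rule sum.mono_neutral_cong_left) (auto simp: N_def c_def)
    finally show "Re (g x) = Re (\<Sum>i\<le>N. c i * of_real x ^ i)" by (simp flip: of_real_power)
    have "Im (g x) = (\<Sum>i\<le>l. q i * x ^ i)" using fun_cong[OF q, of x] by simp
    also have "\<dots> = (\<Sum>i\<le>N. Im (c i) * x ^ i)"
      by (rule sum.mono_neutral_cong_left) (auto simp: N_def c_def)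
    finally show "Im (g x) = Im (\<Sum>i\<le>N. c i * of_real x ^ i)" by (simp flip: of_real_power)
  qed
  with g(2) that show ?thesis by metis
qed

lemma norm_sum_mset_diff_le:
  fixes F P :: "'a \<Rightarrow> complex" and e :: real
  assumes "\<And>z. z \<in># X \<Longrightarrow> norm (F z - P z) \<le> e"
  shows "norm ((\<Sum>z\<in>#X. F z) - (\<Sum>z\<in>#X. P z)) \<le> real (size X) * e"
  using assms
proof (induction X)
  case (add x X)
  have "norm ((\<Sum>z\<in>#add_mset x X. F z) - (\<Sum>z\<in>#add_mset x X. P z))
      = norm ((F x - P x) + ((\<Sum>z\<in>#X. F z) - (\<Sum>z\<in>#X. P z)))"
    by (simp add: algebra_simps)
  also have "\<dots> \<le> e + real (size X) * e"
    using add by (intro norm_triangle_mono) auto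
  finally show ?case by (simp add: algebra_simps)
qed simp

lemma sum_mset_polynomial:
  fixes c :: "nat \<Rightarrow> complex"
  shows "(\<Sum>z\<in>#X. \<Sum>i\<le>N. c i * z ^ i) = (\<Sum>i\<le>N. c i * (\<Sum>z\<in>#X. z ^ i))"
  by (induction X) (simp_all add: sum.distrib distrib_left)

text \<open>
  Since all points lie in the real interval \<open>[-M, M]\<close>, a test function matters only there, and
  there it is a uniform limit of polynomials. Polynomial averages converge by linearity from the
  moments; a uniform error \<open>e\<close> in the test function costs at most \<open>e\<close> in every average, on both
  sides of the limit. The same approximation shows that the averages of an arbitrary continuous
  test function depend continuously on \<open>\<theta>\<close>, which is what makes the limit integral meaningful
  without choosing measurable branches of the eigenvalues.
\<close>

lemma moment_convergence_imp_distribution: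
  fixes \<mu> :: "nat \<Rightarrow> complex multiset" and \<nu> :: "real \<Rightarrow> complex multiset"
  assumes ab: "a < b" and r: "0 < r"
    and \<mu>: "\<And>n z. z \<in># \<mu> n \<Longrightarrow> z \<in> \<real> \<and> norm z \<le> M"
    and \<nu>: "\<And>\<theta> z. z \<in># \<nu> \<theta> \<Longrightarrow> z \<in> \<real> \<and> norm z \<le> M"
    and size_\<nu>: "\<And>\<theta>. size (\<nu> \<theta>) = r"
    and cont: "\<And>k. continuous_on {a..b} (\<lambda>\<theta>. \<Sum>z\<in>#\<nu> \<theta>. z ^ k)"
    and mom: "\<And>k. (\<lambda>n. (\<Sum>z\<in>#\<mu> n. z ^ k) / of_nat (size (\<mu> n))) \<longlonglongrightarrow>
      complex_of_real (1 / (b - a)) * integral {a..b} (\<lambda>\<theta>. (\<Sum>z\<in>#\<nu> \<theta>. z ^ k) / of_nat r)"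
    and F: "continuous_on UNIV (F :: complex \<Rightarrow> complex)"
  shows "continuous_on {a..b} (\<lambda>\<theta>. (\<Sum>z\<in>#\<nu> \<theta>. F z) / of_nat r)" (is ?cont)
    and "(\<lambda>n. (\<Sum>z\<in>#\<mu> n. F z) / of_nat (size (\<mu> n))) \<longlonglongrightarrow>
      complex_of_real (1 / (b - a)) * integral {a..b} (\<lambda>\<theta>. (\<Sum>z\<in>#\<nu> \<theta>. F z) / of_nat r)" (is ?lim)
proof -
  define avg where "avg G X = (\<Sum>z\<in>#X. G z) / of_nat (size X)" for G :: "complex \<Rightarrow> complex" and X
  define I where "I G = complex_of_real (1 / (b - a)) * integral {a..b} (\<lambda>\<theta>. avg G (\<nu> \<theta>))" for G
  have poly_cont: "continuous_on {a..b} (\<lambda>\<theta>. avg (\<lambda>z. \<Sum>i\<le>N. c i * z ^ i) (\<nu> \<theta>))" for c N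
    unfolding avg_def sum_mset_polynomial size_\<nu>
    by (intro continuous_intros cont) (use r in auto)
  have poly_lim: "(\<lambda>n. avg (\<lambda>z. \<Sum>i\<le>N. c i * z ^ i) (\<mu> n)) \<longlonglongrightarrow> I (\<lambda>z. \<Sum>i\<le>N. c i * z ^ i)" for c N
  proof -
    have int: "(\<lambda>\<theta>. c i * ((\<Sum>z\<in>#\<nu> \<theta>. z ^ i) / of_nat r)) integrable_on {a..b}" for i
      by (intro integrable_continuous_real continuous_intros cont) (use r in auto)
    have "I (\<lambda>z. \<Sum>i\<le>N. c i * z ^ i) = complex_of_real (1 / (b - a)) *
        integral {a..b} (\<lambda>\<theta>. \<Sum>i\<le>N. c i * ((\<Sum>z\<in>#\<nu> \<theta>. z ^ i) / of_nat r))"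
      unfolding I_def avg_def sum_mset_polynomial size_\<nu> by (simp add: sum_divide_distrib)
    also have "\<dots> = (\<Sum>i\<le>N. c i * (complex_of_real (1 / (b - a)) *
        integral {a..b} (\<lambda>\<theta>. (\<Sum>z\<in>#\<nu> \<theta>. z ^ i) / of_nat r)))"
      unfolding integral_sum[OF finite_atMost int] integral_mult_right sum_distrib_left
      by (simp only: mult.left_commute)
    finally have I: "I (\<lambda>z. \<Sum>i\<le>N. c i * z ^ i) = \<dots>" .
    have S: "(\<lambda>n. avg (\<lambda>z. \<Sum>i\<le>N. c i * z ^ i) (\<mu> n)) =
        (\<lambda>n. \<Sum>i\<le>N. c i * ((\<Sum>z\<in>#\<mu> n. z ^ i) / of_nat (size (\<mu> n))))"
      unfolding avg_def sum_mset_polynomial by (simp only: sum_divide_distrib times_divide_eq_right)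
    show ?thesis unfolding I S by (intro tendsto_sum tendsto_mult tendsto_const mom)
  qed
  have approx: "\<exists>c N. \<forall>X. (\<forall>z\<in>#X. z \<in> \<real> \<and> norm z \<le> M) \<longrightarrow>
      norm (avg F X - avg (\<lambda>z. \<Sum>i\<le>N. c i * z ^ i) X) \<le> e" if e: "0 < e" for e
  proof -
    have "continuous_on {-M..M} (\<lambda>x. F (of_real x))"
      by (intro continuous_on_compose2[OF F]) (auto intro!: continuous_intros)
    from approx_by_complex_polynomial[OF this e] obtain c N where
      cN: "\<And>x. x \<in> {-M..M} \<Longrightarrow> norm (F (of_real x) - (\<Sum>i\<le>N. c i * of_real x ^ i)) < e"
      by metis
    have "norm (avg F X - avg (\<lambda>z. \<Sum>i\<le>N. c i * z ^ i) X) \<le> e"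
      if X: "\<forall>z\<in>#X. z \<in> \<real> \<and> norm z \<le> M" for X
    proof -
      have "norm (F z - (\<Sum>i\<le>N. c i * z ^ i)) \<le> e" if "z \<in># X" for z
      proof -
        from X that obtain x where "z = of_real x" "x \<in> {-M..M}"
          by (auto elim!: Reals_cases simp: abs_le_iff)
        with cN[of x] show ?thesis by simp
      qed
      from norm_sum_mset_diff_le[of X F, OF this]
      have "norm ((\<Sum>z\<in>#X. F z) - (\<Sum>z\<in>#X. \<Sum>i\<le>N. c i * z ^ i)) \<le> real (size X) * e" .
      then show ?thesis
        using e by (cases "X = {#}")
          (simp_all add: avg_def norm_divide pos_divide_le_eq nonempty_has_size mult.commute
            flip: diff_divide_distrib)
    qed
    then show ?thesis by blast
  qed
  have cont_F: "continuous_on {a..b} (\<lambda>\<theta>. avg F (\<nu> \<theta>))"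
  proof -
    have "\<forall>n. \<exists>c N. \<forall>X. (\<forall>z\<in>#X. z \<in> \<real> \<and> norm z \<le> M) \<longrightarrow>
        norm (avg F X - avg (\<lambda>z. \<Sum>i\<le>N. c i * z ^ i) X) \<le> 1 / Suc n"
      using approx by simp
    then obtain c N where cN: "\<And>n X. (\<forall>z\<in>#X. z \<in> \<real> \<and> norm z \<le> M) \<Longrightarrow>
        norm (avg F X - avg (\<lambda>z. \<Sum>i\<le>N n. c n i * z ^ i) X) \<le> 1 / Suc n"
      by metis
    have "uniform_limit {a..b} (\<lambda>n \<theta>. avg (\<lambda>z. \<Sum>i\<le>N n. c n i * z ^ i) (\<nu> \<theta>))
        (\<lambda>\<theta>. avg F (\<nu> \<theta>)) sequentially"
    proof (rule uniform_limitI)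
      fix e :: real assume "0 < e"
      from order_tendstoD(2)[OF LIMSEQ_inverse_real_of_nat this]
      show "\<forall>\<^sub>F n in sequentially. \<forall>\<theta>\<in>{a..b}.
          dist (avg (\<lambda>z. \<Sum>i\<le>N n. c n i * z ^ i) (\<nu> \<theta>)) (avg F (\<nu> \<theta>)) < e"
      proof eventually_elim
        case (elim n)
        show ?case
        proof
          fix \<theta>
          have "norm (avg F (\<nu> \<theta>) - avg (\<lambda>z. \<Sum>i\<le>N n. c n i * z ^ i) (\<nu> \<theta>)) \<le> 1 / Suc n"
            using cN \<nu> by blast
          with elim show "dist (avg (\<lambda>z. \<Sum>i\<le>N n. c n i * z ^ i) (\<nu> \<theta>)) (avg F (\<nu> \<theta>)) < e"
            by (simp add: dist_norm norm_minus_commute inverse_eq_divide)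
        qed
      qed
    qed
    then show ?thesis
      by (rule uniform_limit_theorem[rotated]) (auto simp: poly_cont)
  qed
  then show ?cont by (simp add: avg_def size_\<nu>)
  have "(\<lambda>n. avg F (\<mu> n)) \<longlonglongrightarrow> I F"
  proof (rule LIMSEQ_I)
    fix e :: real assume e: "0 < e"
    then have e3: "0 < e / 3" by simp
    from approx[OF e3] obtain c N where
      cN: "\<And>X. (\<forall>z\<in>#X. z \<in> \<real> \<and> norm z \<le> M) \<Longrightarrow>
        norm (avg F X - avg (\<lambda>z. \<Sum>i\<le>N. c i * z ^ i) X) \<le> e / 3"
      by blast
    define P where "P = (\<lambda>z. \<Sum>i\<le>N. c i * z ^ i)"
    have poly_cont: "continuous_on {a..b} (\<lambda>\<theta>. avg P (\<nu> \<theta>))"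
      unfolding P_def by (rule poly_cont)
    have poly_lim: "(\<lambda>n. avg P (\<mu> n)) \<longlonglongrightarrow> I P"
      unfolding P_def by (rule poly_lim)
    have "norm (integral {a..b} (\<lambda>\<theta>. avg F (\<nu> \<theta>) - avg P (\<nu> \<theta>))) \<le> e / 3 * (b - a)"
    proof (rule integral_bound)
      fix \<theta>
      show "norm (avg F (\<nu> \<theta>) - avg P (\<nu> \<theta>)) \<le> e / 3"
        unfolding P_def using cN \<nu> by blast
    qed (use ab cont_F poly_cont in \<open>auto intro!: continuous_intros\<close>)
    then have "norm (integral {a..b} (\<lambda>\<theta>. avg F (\<nu> \<theta>) - avg P (\<nu> \<theta>))) / (b - a) \<le> e / 3"
      using ab by (simp only: pos_divide_le_eq diff_gt_0_iff_gt)
    moreover have "I F - I P =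
        complex_of_real (1 / (b - a)) * integral {a..b} (\<lambda>\<theta>. avg F (\<nu> \<theta>) - avg P (\<nu> \<theta>))"
      unfolding I_def using cont_F poly_cont
      by (subst integral_diff) (auto intro!: integrable_continuous_real simp: right_diff_distrib)
    ultimately have IFP: "norm (I F - I P) \<le> e / 3"
      using ab by (simp add: norm_mult norm_divide flip: of_real_diff)
    from LIMSEQ_D[OF poly_lim e3] obtain n0 where
      n0: "\<And>n. n \<ge> n0 \<Longrightarrow> norm (avg P (\<mu> n) - I P) < e / 3" by blast
    show "\<exists>n0. \<forall>n\<ge>n0. norm (avg F (\<mu> n) - I F) < e"
    proof (intro exI allI impI)
      fix n assume "n0 \<le> n"
      note * = n0[OF this]
      have "norm (avg F (\<mu> n) - avg P (\<mu> n)) \<le> e / 3"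
        unfolding P_def using cN \<mu> by blast
      moreover have "avg F (\<mu> n) - I F =
          (avg F (\<mu> n) - avg P (\<mu> n)) + (avg P (\<mu> n) - I P) + (I P - I F)" by simp
      ultimately show "norm (avg F (\<mu> n) - I F) < e"
        using * IFP norm_triangle_ineq[of "avg F (\<mu> n) - avg P (\<mu> n)" "avg P (\<mu> n) - I P"]
          norm_triangle_ineq[of "(avg F (\<mu> n) - avg P (\<mu> n)) + (avg P (\<mu> n) - I P)" "I P - I F"]
        by (simp add: norm_minus_commute)
    qed
  qed
  then show ?lim by (simp add: avg_def I_def size_\<nu>)
qed

section \<open>Hermitian symbols of degree one and their Laurent operators\<close>

text \<open>
  The finite element symbol has Fourier modes \<open>-1, 0, 1\<close> only, and it takes Hermitian values.
  The moments depend on nothing else.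
\<close>

locale tridiagonal_symbol =
  fixes r :: nat and A0 A1 A2 :: "complex mat"
  assumes r: "0 < r"
    and carrier: "A0 \<in> carrier_mat r r" "A1 \<in> carrier_mat r r" "A2 \<in> carrier_mat r r"
    and herm0: "\<And>i j. i < r \<Longrightarrow> j < r \<Longrightarrow> A0 $$ (j, i) = cnj (A0 $$ (i, j))"
    and herm1: "\<And>i j. i < r \<Longrightarrow> j < r \<Longrightarrow> A2 $$ (j, i) = cnj (A1 $$ (i, j))"
begin

definition symbol :: "real \<Rightarrow> complex mat" where
  "symbol \<theta> = A0 + exp (\<i> * complex_of_real \<theta>) \<cdot>\<^sub>m A1 + exp (- \<i> * complex_of_real \<theta>) \<cdot>\<^sub>m A2"

lemma symbol_carrier [simp]: "symbol \<theta> \<in> carrier_mat r r"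
  using carrier by (simp add: symbol_def)

lemma symbol_pow_carrier [simp]: "symbol \<theta> ^\<^sub>m k \<in> carrier_mat r r"
  by simp

lemma symbol_index: "a < r \<Longrightarrow> b < r \<Longrightarrow> symbol \<theta> $$ (a, b) = A0 $$ (a, b) +
    exp (\<i> * complex_of_real \<theta>) * A1 $$ (a, b) + exp (- \<i> * complex_of_real \<theta>) * A2 $$ (a, b)"
  using carrier by (simp add: symbol_def)

lemma symbol_pow_Suc_index: "a < r \<Longrightarrow> b < r \<Longrightarrow>
    (symbol \<theta> ^\<^sub>m Suc k) $$ (a, b) = (\<Sum>c<r. (symbol \<theta> ^\<^sub>m k) $$ (a, c) * symbol \<theta> $$ (c, b))"
  using symbol_carrier[of \<theta>] symbol_pow_carrier[of \<theta> k]
  by (simp add: scalar_prod_def lessThan_atLeast0 del: symbol_carrier symbol_pow_carrier)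

lemma continuous_symbol_pow:
  "a < r \<Longrightarrow> b < r \<Longrightarrow> continuous_on S (\<lambda>\<theta>. (symbol \<theta> ^\<^sub>m k) $$ (a, b))"
proof (induction k arbitrary: b)
  case 0
  have "(symbol \<theta> ^\<^sub>m 0) $$ (a, b) = (if a = b then 1 else 0)" for \<theta>
    using 0 symbol_carrier[of \<theta>] by (simp del: symbol_carrier)
  then show ?case by simp
next
  case (Suc k)
  have "continuous_on S (\<lambda>\<theta>. (symbol \<theta> ^\<^sub>m k) $$ (a, c) * symbol \<theta> $$ (c, b))" if "c < r" for c
    using Suc.IH[OF Suc.prems(1) that] Suc.prems(2) that
    by (simp add: symbol_index) (intro continuous_intros)
  then show ?case
    unfolding symbol_pow_Suc_index[OF Suc.prems] by (intro continuous_on_sum) auto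
qed

definition pow_coeff :: "nat \<Rightarrow> int \<Rightarrow> nat \<Rightarrow> nat \<Rightarrow> complex" where
  "pow_coeff k m a b = fourier_coeff r (\<lambda>\<theta>. symbol \<theta> ^\<^sub>m k) m $$ (a, b)"

lemma pow_coeff_integral:
  assumes "a < r" "b < r"
  shows "pow_coeff k m a b = complex_of_real (1 / (2 * pi)) * integral {-pi..pi}
    (\<lambda>\<theta>. (symbol \<theta> ^\<^sub>m k) $$ (a, b) * exp (- \<i> * of_int m * complex_of_real \<theta>))"
  unfolding pow_coeff_def fourier_coeff_def using assms
  by (simp, subst set_lebesgue_integral_continuous) (auto intro!: continuous_intros continuous_symbol_pow)

lemma pow_coeff_0:
  assumes "a < r" "b < r"
  shows "pow_coeff 0 m a b = (if m = 0 \<and> a = b then 1 else 0)"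
proof -
  have d: "(symbol \<theta> ^\<^sub>m 0) $$ (a, b) = (if a = b then 1 else 0)" for \<theta>
    using assms symbol_carrier[of \<theta>] by (simp del: symbol_carrier)
  have I: "integral {-pi..pi} (\<lambda>\<theta>. exp (- \<i> * of_int m * complex_of_real \<theta>)) = 0" if m: "m \<noteq> 0"
  proof -
    define w :: complex where "w = - \<i> * of_int m"
    have w: "w \<noteq> 0" using m by (simp add: w_def)
    have "((\<lambda>\<theta>. exp (w * complex_of_real \<theta>)) has_integral
        (exp (w * complex_of_real pi) / w - exp (w * complex_of_real (- pi)) / w)) {-pi..pi}"
    proof (rule fundamental_theorem_of_calculus)
      fix x :: real
      show "((\<lambda>\<theta>. exp (w * complex_of_real \<theta>) / w) has_vector_derivative
          exp (w * complex_of_real x)) (at x within {-pi..pi})"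
        using w by (auto intro!: derivative_eq_intros has_vector_derivative_real_field)
    qed simp
    moreover have "exp (w * complex_of_real pi) = exp (w * complex_of_real (- pi))"
    proof -
      have "exp (w * complex_of_real (- pi)) =
          exp (w * complex_of_real pi) * exp (2 * of_int m * of_real pi * \<i>)"
        by (simp add: w_def mult.assoc flip: exp_add)
      also have "exp (2 * of_int m * of_real pi * \<i>) = 1"
        by (subst exp_eq_1) auto
      finally show ?thesis by simp
    qed
    ultimately show ?thesis by (simp add: w_def integral_unique)
  qed
  show ?thesis
    unfolding pow_coeff_integral[OF assms] d using I by (auto simp: scaleR_conv_of_real)
qed

text \<open>
  Multiplying by the symbol shifts the Fourier index by \<open>-1\<close>, \<open>0\<close> or \<open>1\<close>: the exponentials
  \<open>exp (\<plusminus>\<i> \<theta>)\<close> of the symbol are absorbed into the kernel \<open>exp (-\<i> m \<theta>)\<close>.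
\<close>

lemma pow_coeff_Suc:
  assumes a: "a < r" and b: "b < r"
  shows "pow_coeff (Suc k) m a b = (\<Sum>c<r. pow_coeff k m a c * A0 $$ (c, b)
    + pow_coeff k (m - 1) a c * A1 $$ (c, b) + pow_coeff k (m + 1) a c * A2 $$ (c, b))"
proof -
  let ?g = "\<lambda>c m \<theta>. (symbol \<theta> ^\<^sub>m k) $$ (a, c) * exp (- \<i> * of_int m * complex_of_real \<theta>)"
  have int: "?g c m integrable_on {-pi..pi}" if "c < r" for c m
    using that a by (intro integrable_continuous_real continuous_intros continuous_symbol_pow)
  have "(symbol \<theta> ^\<^sub>m Suc k) $$ (a, b) * exp (- \<i> * of_int m * complex_of_real \<theta>) =
      (\<Sum>c<r. ?g c m \<theta> * A0 $$ (c, b) + ?g c (m - 1) \<theta> * A1 $$ (c, b) + ?g c (m + 1) \<theta> * A2 $$ (c, b))" for \<theta>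
  proof -
    have e1: "exp (- \<i> * of_int (m - 1) * complex_of_real \<theta>) =
        exp (- \<i> * of_int m * complex_of_real \<theta>) * exp (\<i> * complex_of_real \<theta>)"
      by (simp add: algebra_simps flip: exp_add)
    have e2: "exp (- \<i> * of_int (m + 1) * complex_of_real \<theta>) =
        exp (- \<i> * of_int m * complex_of_real \<theta>) * exp (- \<i> * complex_of_real \<theta>)"
      by (simp add: algebra_simps flip: exp_add)
    show ?thesis
      unfolding symbol_pow_Suc_index[OF a b] e1 e2 sum_distrib_right
      by (rule sum.cong) (use b in \<open>simp_all add: symbol_index algebra_simps\<close>)
  qed
  then have "pow_coeff (Suc k) m a b = complex_of_real (1 / (2 * pi)) * integral {-pi..pi}
      (\<lambda>\<theta>. \<Sum>c<r. ?g c m \<theta> * A0 $$ (c, b) + ?g c (m - 1) \<theta> * A1 $$ (c, b) + ?g c (m + 1) \<theta> * A2 $$ (c, b))"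
    unfolding pow_coeff_integral[OF a b] by simp
  also have "integral {-pi..pi}
      (\<lambda>\<theta>. \<Sum>c<r. ?g c m \<theta> * A0 $$ (c, b) + ?g c (m - 1) \<theta> * A1 $$ (c, b) + ?g c (m + 1) \<theta> * A2 $$ (c, b))
    = (\<Sum>c<r. integral {-pi..pi} (?g c m) * A0 $$ (c, b) + integral {-pi..pi} (?g c (m - 1)) * A1 $$ (c, b)
      + integral {-pi..pi} (?g c (m + 1)) * A2 $$ (c, b))"
    by (intro integral_unique has_integral_sum has_integral_add has_integral_mult_left
        integrable_integral int) auto
  also have "complex_of_real (1 / (2 * pi)) * \<dots> = (\<Sum>c<r. pow_coeff k m a c * A0 $$ (c, b)
      + pow_coeff k (m - 1) a c * A1 $$ (c, b) + pow_coeff k (m + 1) a c * A2 $$ (c, b))"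
    unfolding sum_distrib_left
    by (intro sum.cong refl) (simp only: pow_coeff_integral[OF a] lessThan_iff distrib_left mult.assoc)
  finally show ?thesis .
qed

lemma pow_coeff_1:
  assumes a: "a < r" and b: "b < r"
  shows "pow_coeff 1 m a b = (if m = 0 then A0 $$ (a, b) else if m = 1 then A1 $$ (a, b)
    else if m = -1 then A2 $$ (a, b) else 0)"
proof -
  have "pow_coeff 1 m a b = (\<Sum>c<r. if c = a then (if m = 0 then A0 $$ (a, b) else if m = 1 then A1 $$ (a, b)
    else if m = -1 then A2 $$ (a, b) else 0) else 0)"
    unfolding One_nat_def pow_coeff_Suc[OF a b]
    by (rule sum.cong) (use a in \<open>auto simp: pow_coeff_0\<close>)
  then show ?thesis using a by simp
qed

text \<open>
  The form of the recurrence that is recognisable as a product of block Laurent matrices.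
\<close>

lemma pow_coeff_convolution:
  assumes "a < r" "b < r"
  shows "pow_coeff (Suc k) m a b = (\<Sum>t\<in>{-1, 0, 1}. \<Sum>c<r. pow_coeff k (m - t) a c * pow_coeff 1 t c b)"
  unfolding pow_coeff_Suc[OF assms] using assms by (simp add: pow_coeff_1 sum.distrib del: One_nat_def)

lemma pow_coeff_band: "a < r \<Longrightarrow> b < r \<Longrightarrow> int k < \<bar>m\<bar> \<Longrightarrow> pow_coeff k m a b = 0"
proof (induction k arbitrary: m b)
  case (Suc k)
  show ?case
    unfolding pow_coeff_Suc[OF Suc.prems(1,2)]
    by (rule sum.neutral) (use Suc in auto)
qed (simp add: pow_coeff_0)

text \<open>
  The entries of the doubly infinite block Toeplitz matrix with symbol \<open>f\<^sup>k\<close>, where \<open>f\<close> is the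
  given symbol. An integer index encodes the pair of its block number (quotient by \<open>r\<close>) and its
  place in the block (remainder). On the doubly infinite index set there is no boundary, so these
  matrices multiply exactly as the symbols do.
\<close>

definition laurent :: "nat \<Rightarrow> int \<Rightarrow> int \<Rightarrow> complex" where
  "laurent k p q = pow_coeff k (p div int r - q div int r) (nat (p mod int r)) (nat (q mod int r))"

lemma nat_mod_less [simp]: "nat (p mod int r) < r"
  using r by (simp add: nat_less_iff)

lemma laurent_0: "laurent 0 p q = (if p = q then 1 else 0)"
proof -
  have "p div int r = q div int r \<and> nat (p mod int r) = nat (q mod int r) \<longleftrightarrow> p = q"
    using r by (metis div_mult_mod_eq eq_nat_nat_iff of_nat_0_less_iff pos_mod_sign)
  then show ?thesis by (simp add: laurent_def pow_coeff_0)
qed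

lemma laurent_band: "int k < \<bar>p div int r - q div int r\<bar> \<Longrightarrow> laurent k p q = 0"
  by (simp add: laurent_def pow_coeff_band)

text \<open>
  The indices in the block of \<open>q\<close> and in its two neighbours, the only ones that the matrix
  with symbol \<open>f\<close> couples to \<open>q\<close>.
\<close>

definition adjacent_blocks :: "int \<Rightarrow> int set" where
  "adjacent_blocks q = {(q div int r - 1) * int r..<(q div int r + 2) * int r}"

lemma mem_adjacent_blocks_iff: "s \<in> adjacent_blocks q \<longleftrightarrow> \<bar>s div int r - q div int r\<bar> \<le> 1"
proof -
  have le: "x * int r \<le> s \<longleftrightarrow> x \<le> s div int r" for x
  proof
    assume "x * int r \<le> s"
    from zdiv_mono1[OF this, of "int r"] show "x \<le> s div int r" using r by simp
  next
    assume "x \<le> s div int r"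
    then have "x * int r \<le> s div int r * int r" by (intro mult_right_mono) auto
    also have "\<dots> \<le> s" using r by (simp add: minus_mod_eq_div_mult [symmetric])
    finally show "x * int r \<le> s" .
  qed
  show ?thesis
    using le[of "q div int r - 1"] le[of "q div int r + 2"] by (auto simp: adjacent_blocks_def)
qed

lemma finite_adjacent_blocks [simp]: "finite (adjacent_blocks q)" and card_adjacent_blocks: "card (adjacent_blocks q) = 3 * r"
  by (simp_all add: adjacent_blocks_def algebra_simps)

text \<open>
  The convolution of Fourier coefficients, rewritten over flat indices \<open>s\<close> that stand for pairs
  of a block offset \<open>t\<close> and a place \<open>c\<close> in the block.
\<close>

lemma laurent_Suc: "laurent (Suc k) p q = (\<Sum>s\<in>adjacent_blocks q. laurent k p s * laurent 1 s q)"
proof -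
  let ?g = "\<lambda>(t, c). (q div int r + t) * int r + int c"
  have "laurent (Suc k) p q = (\<Sum>t\<in>{-1, 0, 1}. \<Sum>c<r. pow_coeff k (p div int r - q div int r - t) (nat (p mod int r)) c *
      pow_coeff 1 t c (nat (q mod int r)))"
    by (simp only: laurent_def pow_coeff_convolution nat_mod_less)
  also have "\<dots> = (\<Sum>(t, c)\<in>{-1, 0, 1} \<times> {..<r}. pow_coeff k (p div int r - q div int r - t) (nat (p mod int r)) c *
      pow_coeff 1 t c (nat (q mod int r)))"
    by (rule sum.cartesian_product)
  also have "\<dots> = (\<Sum>s\<in>adjacent_blocks q. laurent k p s * laurent 1 s q)"
  proof (rule sum.reindex_bij_witness[of _ "\<lambda>s. (s div int r - q div int r, nat (s mod int r))" ?g])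
    fix x assume "x \<in> {-1, 0, 1::int} \<times> {..<r}"
    then obtain t c where x: "x = (t, c)" "t \<in> {-1, 0, 1}" "c < r" by auto
    have d: "?g x div int r = q div int r + t" and m: "?g x mod int r = int c"
      using x by simp_all
    show "(?g x div int r - q div int r, nat (?g x mod int r)) = x"
      unfolding d m using x by simp
    show "?g x \<in> adjacent_blocks q" unfolding mem_adjacent_blocks_iff d using x by auto
    show "laurent k p (?g x) * laurent 1 (?g x) q = (case x of (t, c) \<Rightarrow>
        pow_coeff k (p div int r - q div int r - t) (nat (p mod int r)) c * pow_coeff 1 t c (nat (q mod int r)))"
      unfolding laurent_def d m using x by (simp add: algebra_simps)
  next
    fix s assume "s \<in> adjacent_blocks q"
    then have "\<bar>s div int r - q div int r\<bar> \<le> 1" by (simp add: mem_adjacent_blocks_iff)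
    then show "(s div int r - q div int r, nat (s mod int r)) \<in> {-1, 0, 1} \<times> {..<r}" by auto
    show "?g (s div int r - q div int r, nat (s mod int r)) = s" using r by simp
  qed
  finally show ?thesis .
qed

section \<open>Finite sections\<close>

text \<open>
  The section to the indices \<open>1, \<dots>, n r - 1\<close>. The index \<open>0\<close> is left out because the Dirichlet
  condition removes the first node.
\<close>

definition truncation :: "nat \<Rightarrow> complex mat" where
  "truncation n = mat (n * r - 1) (n * r - 1) (\<lambda>(p, q). laurent 1 (int (Suc p)) (int (Suc q)))"

lemma truncation_carrier [simp]: "truncation n \<in> carrier_mat (n * r - 1) (n * r - 1)"
  by (simp add: truncation_def)

lemma truncation_index: "p < n * r - 1 \<Longrightarrow> q < n * r - 1 \<Longrightarrow>
    truncation n $$ (p, q) = laurent 1 (int (Suc p)) (int (Suc q))"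
  by (simp add: truncation_def)

text \<open>
  An entry of the \<open>k\<close>-th power is a sum over walks of \<open>k\<close> steps, each to the same or an adjacent
  block. From a block with number between \<open>k\<close> and \<open>n - k\<close> the first \<open>k - 1\<close> steps reach only the
  blocks \<open>1, \<dots>, n - 1\<close>, all of whose indices belong to the section. The only incomplete block of
  the section, with number \<open>0\<close>, can be met at the last step at the earliest, and there the
  walk ends at the prescribed index. So truncation does not change the entry.
\<close>

lemma truncation_pow_interior:
  assumes p: "p < n * r - 1" "k \<le> Suc p div r" "Suc p div r + k \<le> n" and q: "q < n * r - 1"
  shows "(truncation n ^\<^sub>m k) $$ (p, q) = laurent k (int (Suc p)) (int (Suc q))"
  using p(2,3) q
proof (induction k arbitrary: q)
  case 0
  then show ?case using p(1) by (simp add: laurent_0 truncation_def)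
next
  case (Suc k)
  let ?P = "int (Suc p)" and ?Q = "int (Suc q)"
  let ?h = "\<lambda>s. laurent k ?P s * laurent 1 s ?Q"
  have carr: "truncation n ^\<^sub>m k \<in> carrier_mat (n * r - 1) (n * r - 1)"
    by (rule pow_carrier_mat[OF truncation_carrier])
  have pd: "?P div int r = int (Suc p div r)" by (simp only: zdiv_int)
  have "(truncation n ^\<^sub>m Suc k) $$ (p, q) =
      (\<Sum>s<n * r - 1. (truncation n ^\<^sub>m k) $$ (p, s) * truncation n $$ (s, q))"
    using p(1) Suc.prems(3) carr truncation_carrier[of n]
    by (simp add: scalar_prod_def lessThan_atLeast0 del: truncation_carrier)
  also have "\<dots> = (\<Sum>s<n * r - 1. ?h (int (Suc s)))"
    by (rule sum.cong) (use Suc in \<open>simp_all add: truncation_index\<close>)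
  also have "\<dots> = (\<Sum>s\<in>(\<lambda>s. int (Suc s)) ` {..<n * r - 1}. ?h s)"
    by (subst sum.reindex) (auto simp: inj_on_def)
  also have "\<dots> = (\<Sum>s\<in>adjacent_blocks ?Q. ?h s)"
  proof (rule sum.mono_neutral_cong)
    fix s assume s: "s \<in> adjacent_blocks ?Q - (\<lambda>s. int (Suc s)) ` {..<n * r - 1}"
    have "s < 1 \<or> int (n * r) \<le> s"
    proof (rule ccontr)
      assume "\<not> ?thesis"
      \<comment> \<open>Subtraction in \<open>nat s - 1\<close> is exact because here \<open>s \<ge> 1\<close>.\<close>
      then have "s = int (Suc (nat s - 1))" "nat s - 1 < n * r - 1"
        unfolding de_Morgan_disj not_less not_le by linarith+
      with s show False by blast
    qed
    then have "s div int r \<le> 0 \<or> int n \<le> s div int r"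
    proof
      assume "s < 1"
      then have "s div int r \<le> 0 div int r" using r by (intro zdiv_mono1) auto
      then show ?thesis by simp
    next
      assume "int (n * r) \<le> s"
      then have "int (n * r) div int r \<le> s div int r" using r by (intro zdiv_mono1) auto
      then show ?thesis using r by simp
    qed
    then have "int k < \<bar>?P div int r - s div int r\<bar>"
      unfolding pd using Suc.prems(1,2) by linarith
    then show "?h s = 0" by (simp add: laurent_band)
  next
    fix s assume "s \<in> (\<lambda>s. int (Suc s)) ` {..<n * r - 1} - adjacent_blocks ?Q"
    then have "int 1 < \<bar>s div int r - ?Q div int r\<bar>" by (simp only: mem_adjacent_blocks_iff Diff_iff) linarith
    then have "laurent 1 s ?Q = 0" by (rule laurent_band)
    then show "?h s = 0" by simp
  qed auto
  also have "\<dots> = laurent (Suc k) ?P ?Q" by (simp only: laurent_Suc)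
  finally show ?case .
qed

definition entry_bound :: real where
  "entry_bound = (\<Sum>a<r. \<Sum>b<r. norm (A0 $$ (a, b)) + norm (A1 $$ (a, b)) + norm (A2 $$ (a, b)))"

lemma entry_bound:
  assumes "a < r" "b < r"
  shows "norm (A0 $$ (a, b)) + norm (A1 $$ (a, b)) + norm (A2 $$ (a, b)) \<le> entry_bound"
proof -
  let ?g = "\<lambda>a b. norm (A0 $$ (a, b)) + norm (A1 $$ (a, b)) + norm (A2 $$ (a, b))"
  have "?g a b \<le> (\<Sum>b<r. ?g a b)" by (rule member_le_sum) (use assms in auto)
  also have "\<dots> \<le> entry_bound"
    unfolding entry_bound_def by (rule member_le_sum[where f = "\<lambda>a. \<Sum>b<r. ?g a b"])
      (use assms in \<open>auto intro!: add_nonneg_nonneg sum_nonneg\<close>)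
  finally show ?thesis .
qed

lemma norm_laurent_1_le: "norm (laurent 1 p q) \<le> entry_bound"
proof -
  let ?a = "nat (p mod int r)" and ?b = "nat (q mod int r)"
  have "norm (laurent 1 p q) \<le> norm (A0 $$ (?a, ?b)) + norm (A1 $$ (?a, ?b)) + norm (A2 $$ (?a, ?b))"
    unfolding laurent_def pow_coeff_1[OF nat_mod_less nat_mod_less] by auto
  then show ?thesis using entry_bound[of ?a ?b] by simp
qed

lemma entry_bound_nonneg: "0 \<le> entry_bound"
  using norm_laurent_1_le[of 0 0] norm_ge_zero order_trans by blast

definition spectral_bound :: real where
  "spectral_bound = 3 * real r * entry_bound"

lemma truncation_row_sum:
  assumes p: "p < n * r - 1"
  shows "(\<Sum>q<n * r - 1. norm (truncation n $$ (p, q))) \<le> spectral_bound"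
proof -
  let ?P = "int (Suc p)"
  let ?S = "(\<lambda>s. int (Suc s)) ` {..<n * r - 1}"
  have "(\<Sum>q<n * r - 1. norm (truncation n $$ (p, q))) = (\<Sum>q<n * r - 1. norm (laurent 1 ?P (int (Suc q))))"
    by (rule sum.cong) (use p in \<open>simp_all add: truncation_index\<close>)
  also have "\<dots> = (\<Sum>q\<in>?S. norm (laurent 1 ?P q))"
    by (subst sum.reindex) (auto simp: inj_on_def)
  also have "\<dots> = (\<Sum>q\<in>?S \<inter> adjacent_blocks ?P. norm (laurent 1 ?P q))"
  proof (rule sum.mono_neutral_right)
    show "\<forall>q\<in>?S - ?S \<inter> adjacent_blocks ?P. norm (laurent 1 ?P q) = 0"
    proof
      fix q assume "q \<in> ?S - ?S \<inter> adjacent_blocks ?P"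
      then have "int 1 < \<bar>?P div int r - q div int r\<bar>"
        by (simp only: mem_adjacent_blocks_iff Diff_iff Int_iff) linarith
      then show "norm (laurent 1 ?P q) = 0" by (simp add: laurent_band del: One_nat_def)
    qed
  qed auto
  also have "\<dots> \<le> (\<Sum>q\<in>adjacent_blocks ?P. norm (laurent 1 ?P q))"
    by (rule sum_mono2) auto
  also have "\<dots> \<le> of_nat (card (adjacent_blocks ?P)) * entry_bound"
    by (rule sum_bounded_above) (rule norm_laurent_1_le)
  finally show ?thesis by (simp add: card_adjacent_blocks spectral_bound_def)
qed

lemma symbol_row_sum:
  assumes a: "a < r"
  shows "(\<Sum>b<r. norm (symbol \<theta> $$ (a, b))) \<le> spectral_bound"
proof -
  have "(\<Sum>b<r. norm (symbol \<theta> $$ (a, b))) \<le> of_nat (card {..<r}) * entry_bound"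
  proof (rule sum_bounded_above)
    fix b assume "b \<in> {..<r}"
    then have b: "b < r" by simp
    have "norm (symbol \<theta> $$ (a, b)) \<le> norm (A0 $$ (a, b)) + norm (A1 $$ (a, b)) + norm (A2 $$ (a, b))"
      unfolding symbol_index[OF a b]
      by (intro order_trans[OF norm_triangle_ineq] add_mono) (auto simp: norm_mult)
    with entry_bound[OF a b] show "norm (symbol \<theta> $$ (a, b)) \<le> entry_bound" by simp
  qed
  also have "\<dots> \<le> spectral_bound"
    using entry_bound_nonneg by (simp add: spectral_bound_def mult_right_mono)
  finally show ?thesis .
qed

lemma spectral_bound_nonneg: "0 \<le> spectral_bound"
  using entry_bound_nonneg by (simp add: spectral_bound_def)

lemma laurent_1_hermitian: "laurent 1 q p = cnj (laurent 1 p q)"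
proof -
  let ?a = "nat (p mod int r)" and ?b = "nat (q mod int r)"
  have "A1 $$ (?b, ?a) = cnj (A2 $$ (?a, ?b))"
    using herm1[of ?b ?a] by simp
  then show ?thesis
    unfolding laurent_def pow_coeff_1[OF nat_mod_less nat_mod_less]
    using herm0[of ?a ?b] herm1[of ?a ?b] by auto
qed

lemma truncation_hermitian:
  "i < n * r - 1 \<Longrightarrow> j < n * r - 1 \<Longrightarrow> truncation n $$ (j, i) = cnj (truncation n $$ (i, j))"
  by (simp only: truncation_index laurent_1_hermitian[of "int (Suc j)"])

lemma symbol_hermitian:
  assumes "i < r" "j < r"
  shows "symbol \<theta> $$ (j, i) = cnj (symbol \<theta> $$ (i, j))"
proof -
  have "A1 $$ (j, i) = cnj (A2 $$ (i, j))" using herm1[of j i] assms by simp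
  then show ?thesis
    using assms herm0[OF assms] herm1[OF assms] by (simp add: symbol_index exp_cnj)
qed

lemma sum_laurent_diag:
  "(\<Sum>p<n * r. laurent k (int p) (int p)) = of_nat n * (\<Sum>a<r. pow_coeff k 0 a a)"
proof -
  have "(\<Sum>p\<in>{m * r..<m * r + r}. laurent k (int p) (int p)) = (\<Sum>a<r. pow_coeff k 0 a a)" for m
  proof (rule sum.reindex_bij_witness[of _ "\<lambda>a. m * r + a" "\<lambda>p. p - m * r"])
    fix p assume p: "p \<in> {m * r..<m * r + r}"
    then have "int p mod int r = int (p - m * r)"
      by (metis add_diff_inverse_nat atLeastLessThan_iff less_diff_conv2 linorder_not_less
        mod_less mod_mult_self3 nat_mod_distrib of_nat_mod add.commute)
    then show "pow_coeff k 0 (p - m * r) (p - m * r) = laurent k (int p) (int p)"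
      by (simp add: laurent_def)
  qed auto
  then show ?thesis
    unfolding sum.nat_group[symmetric] by simp
qed

text \<open>
  The traces of the section and of \<open>n\<close> periods of the Laurent matrix differ only on the diagonal
  entries within \<open>k\<close> blocks of the boundary and on the missing index \<open>0\<close>. Their number does not
  grow with \<open>n\<close>, and each of them is bounded because the row sums of the sections are.
\<close>

lemma truncation_trace_bound:
  "\<exists>B. \<forall>n\<ge>1. norm ((\<Sum>i<n * r - 1. (truncation n ^\<^sub>m k) $$ (i, i)) - of_nat n * (\<Sum>a<r. pow_coeff k 0 a a)) \<le> B"
proof (intro exI allI impI)
  fix n :: nat assume n: "1 \<le> n"
  define S' where "S' = (\<Sum>a<r. norm (pow_coeff k 0 a a))"
  have Lb: "norm (laurent k p p) \<le> S'" for p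
    unfolding laurent_def S'_def
    by (simp, rule member_le_sum[where f = "\<lambda>a. norm (pow_coeff k 0 a a)"]) auto
  have S'0: "0 \<le> S'" unfolding S'_def by (rule sum_nonneg) simp
  let ?A = "truncation n ^\<^sub>m k"
  let ?d = "\<lambda>i. ?A $$ (i, i) - laurent k (int (Suc i)) (int (Suc i))"
  \<comment> \<open>Positions whose walks of length \<open>k\<close> may feel the truncation.\<close>
  let ?E = "{..<k * r} \<union> {(n - k) * r..<n * r}"
  have nr: "n * r = Suc (n * r - 1)" using n r by simp
  have "(\<Sum>p<n * r. laurent k (int p) (int p)) =
      laurent k 0 0 + (\<Sum>i<n * r - 1. laurent k (int (Suc i)) (int (Suc i)))"
    by (subst nr, subst sum.lessThan_Suc_shift) simp
  then have "(\<Sum>i<n * r - 1. ?A $$ (i, i)) - of_nat n * (\<Sum>a<r. pow_coeff k 0 a a) =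
      (\<Sum>i<n * r - 1. ?d i) - laurent k 0 0"
    by (simp add: sum_laurent_diag sum_subtractf)
  also have "(\<Sum>i<n * r - 1. ?d i) = (\<Sum>i\<in>{..<n * r - 1} \<inter> ?E. ?d i)"
  proof (rule sum.mono_neutral_right)
    show "\<forall>i\<in>{..<n * r - 1} - {..<n * r - 1} \<inter> ?E. ?d i = 0"
    proof
      fix i assume "i \<in> {..<n * r - 1} - {..<n * r - 1} \<inter> ?E"
      then have i: "i < n * r - 1" "k * r \<le> i" "i < (n - k) * r" by auto
      have "k \<le> Suc i div r" using i(2) r by (simp add: less_eq_div_iff_mult_less_eq)
      moreover have "Suc i div r \<le> n - k"
        using div_le_mono[of "Suc i" "(n - k) * r" r] i(3) r by simp
      moreover have "k < n" using i(3) by (cases "k < n") auto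
      ultimately show "?d i = 0"
        using truncation_pow_interior[OF i(1), of k i] i(1) by simp
    qed
  qed auto
  also have "norm ((\<Sum>i\<in>{..<n * r - 1} \<inter> ?E. ?d i) - laurent k 0 0) \<le>
      real (2 * k * r) * (spectral_bound ^ k + S') + S'"
  proof -
    have d: "norm (?d i) \<le> spectral_bound ^ k + S'" if i: "i \<in> {..<n * r - 1} \<inter> ?E" for i
    proof -
      from i have i: "i < n * r - 1" by simp
      have "norm (?A $$ (i, i)) \<le> (\<Sum>j<n * r - 1. norm (?A $$ (i, j)))"
        by (rule member_le_sum) (use i in auto)
      also have "\<dots> \<le> spectral_bound ^ k"
        by (rule row_sum_pow_le[OF truncation_carrier i truncation_row_sum])
      finally show ?thesis
        using Lb[of "int (Suc i)"] norm_triangle_ineq4[of "?A $$ (i, i)" "laurent k (int (Suc i)) (int (Suc i))"]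
        by linarith
    qed
    have card: "card ({..<n * r - 1} \<inter> ?E) \<le> 2 * k * r"
    proof -
      have "card ({..<n * r - 1} \<inter> ?E) \<le> card ?E" by (intro card_mono) auto
      also have "\<dots> \<le> k * r + (n * r - (n - k) * r)"
        using card_Un_le[of "{..<k * r}" "{(n - k) * r..<n * r}"] by simp
      also have "n * r - (n - k) * r \<le> k * r"
        by (cases "k \<le> n") (auto simp flip: diff_mult_distrib)
      finally show ?thesis by simp
    qed
    have "norm (\<Sum>i\<in>{..<n * r - 1} \<inter> ?E. ?d i) \<le>
        real (card ({..<n * r - 1} \<inter> ?E)) * (spectral_bound ^ k + S')"
      by (rule sum_norm_bound) (rule d)
    also have "\<dots> \<le> real (2 * k * r) * (spectral_bound ^ k + S')"
      using card S'0 spectral_bound_nonneg by (intro mult_right_mono) (auto simp flip: of_nat_mult)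
    finally show ?thesis
      using Lb[of 0] norm_triangle_ineq4[of "\<Sum>i\<in>{..<n * r - 1} \<inter> ?E. ?d i" "laurent k 0 0"]
      by linarith
  qed
  finally show "norm ((\<Sum>i<n * r - 1. ?A $$ (i, i)) - of_nat n * (\<Sum>a<r. pow_coeff k 0 a a)) \<le>
    real (2 * k * r) * (spectral_bound ^ k + (\<Sum>a<r. norm (pow_coeff k 0 a a))) + (\<Sum>a<r. norm (pow_coeff k 0 a a))"
    by (simp add: S'_def)
qed

text \<open>
  Both limits are the normalised diagonal sum of the zeroth Fourier coefficient of \<open>f\<^sup>k\<close>: for the
  integral this is the definition of that coefficient, for the sections it is
  \<open>truncation_trace_bound\<close> divided by the dimension \<open>n r - 1\<close>.
\<close>

lemma truncation_moments:
  "(\<lambda>n. (\<Sum>z\<in>#eigvals (truncation n). z ^ k) / of_nat (size (eigvals (truncation n)))) \<longlonglongrightarrow>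
    complex_of_real (1 / (pi - - pi)) * integral {-pi..pi} (\<lambda>\<theta>. (\<Sum>z\<in>#eigvals (symbol \<theta>). z ^ k) / of_nat r)"
proof -
  define S where "S = (\<Sum>a<r. pow_coeff k 0 a a)"
  define T where "T n = (\<Sum>i<n * r - 1. (truncation n ^\<^sub>m k) $$ (i, i))" for n
  obtain B where B: "\<And>n. n \<ge> 1 \<Longrightarrow> norm (T n - of_nat n * S) \<le> B"
    using truncation_trace_bound[of k] unfolding T_def S_def by blast
  have ev: "\<forall>\<^sub>F n in sequentially. real (n * r - 1) = real n * real r - 1"
    using eventually_ge_at_top[of 1] by eventually_elim (use r in \<open>simp add: of_nat_diff\<close>)
  have r': "0 < real r" using r by simp
  have lim1: "(\<lambda>n. real n / real (n * r - 1)) \<longlonglongrightarrow> 1 / real r"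
  proof (rule Lim_transform_eventually)
    show "(\<lambda>n. real n / (real n * real r - 1)) \<longlonglongrightarrow> 1 / real r"
      using r' by (real_asymp simp: inverse_eq_divide)
    show "\<forall>\<^sub>F n in sequentially. real n / (real n * real r - 1) = real n / real (n * r - 1)"
      using ev by eventually_elim simp
  qed
  have lim2: "(\<lambda>n. B / real (n * r - 1)) \<longlonglongrightarrow> 0"
  proof (rule Lim_transform_eventually)
    show "(\<lambda>n. B / (real n * real r - 1)) \<longlonglongrightarrow> 0"
      using r' by real_asymp
    show "\<forall>\<^sub>F n in sequentially. B / (real n * real r - 1) = B / real (n * r - 1)"
      using ev by eventually_elim simp
  qed
  have "(\<lambda>n. (T n - of_nat n * S) / of_nat (n * r - 1)) \<longlonglongrightarrow> 0"
  proof (rule Lim_null_comparison[OF _ lim2])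
    show "\<forall>\<^sub>F n in sequentially. norm ((T n - of_nat n * S) / of_nat (n * r - 1)) \<le> B / real (n * r - 1)"
      using eventually_ge_at_top[of 1]
      by eventually_elim (simp only: norm_divide norm_of_nat, intro divide_right_mono B, auto)
  qed
  moreover have "(\<lambda>n. complex_of_real (real n / real (n * r - 1)) * S) \<longlonglongrightarrow> complex_of_real (1 / real r) * S"
    by (intro tendsto_intros tendsto_of_real lim1)
  ultimately have "(\<lambda>n. (T n - of_nat n * S) / of_nat (n * r - 1) + complex_of_real (real n / real (n * r - 1)) * S)
      \<longlonglongrightarrow> 0 + complex_of_real (1 / real r) * S"
    by (rule tendsto_add)
  then have lim: "(\<lambda>n. T n / of_nat (n * r - 1)) \<longlonglongrightarrow> complex_of_real (1 / real r) * S"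
    by (simp add: diff_divide_distrib)
  have "integral {-pi..pi} (\<lambda>\<theta>. (\<Sum>z\<in>#eigvals (symbol \<theta>). z ^ k) / of_nat r) =
      integral {-pi..pi} (\<lambda>\<theta>. (\<Sum>a<r. (symbol \<theta> ^\<^sub>m k) $$ (a, a))) / of_nat r"
    by (simp add: power_sum_eigvals[OF symbol_carrier])
  also have "integral {-pi..pi} (\<lambda>\<theta>. (\<Sum>a<r. (symbol \<theta> ^\<^sub>m k) $$ (a, a))) =
      (\<Sum>a<r. integral {-pi..pi} (\<lambda>\<theta>. (symbol \<theta> ^\<^sub>m k) $$ (a, a)))"
    by (intro integral_sum integrable_continuous_real continuous_symbol_pow) auto
  finally have "complex_of_real (1 / (pi - - pi)) * integral {-pi..pi} (\<lambda>\<theta>. (\<Sum>z\<in>#eigvals (symbol \<theta>). z ^ k) / of_nat r)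
      = complex_of_real (1 / real r) * S"
    by (simp add: S_def pow_coeff_integral sum_distrib_left sum_divide_distrib mult.commute)
  with lim show ?thesis
    by (simp add: power_sum_eigvals[OF truncation_carrier] size_eigvals[OF truncation_carrier] T_def)
qed

lemma truncation_matrix_sequence: "matrix_sequence truncation"
proof -
  have "m * r - 1 < n * r - 1" if "1 \<le> m" "m < n" for m n
  proof -
    have "m * r < n * r" "1 \<le> m * r" using that r by auto
    then show ?thesis by linarith
  qed
  then show ?thesis
    by (auto simp: matrix_sequence_def truncation_def strict_mono_on_def)
qed

lemma symbol_matrix_function: "matrix_function r {-pi..pi} symbol"
proof -
  have "(\<lambda>\<theta>. symbol \<theta> $$ (i, j)) \<in> borel_measurable (lebesgue_on {-pi..pi})" if "i < r" "j < r" for i j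
    by (rule continuous_imp_measurable_on_sets_lebesgue)
      (use that in \<open>auto simp: symbol_index intro!: continuous_intros\<close>)
  then show ?thesis using r by (simp add: matrix_function_def)
qed

theorem truncation_spectral_symbol: "spectral_symbol truncation r {-pi..pi} symbol"
proof -
  have lim: "(\<lambda>n. (\<Sum>z\<in>#eigvals (truncation n). F z) / of_nat (dim_row (truncation n))) \<longlonglongrightarrow>
       complex_of_real (1 / measure lebesgue {-pi..pi}) *
         (LINT \<theta>:{-pi..pi}|lebesgue. (\<Sum>z\<in>#eigvals (symbol \<theta>). F z) / of_nat r)"
    if F: "continuous_on UNIV F" for F
  proof -
    note * = moment_convergence_imp_distribution[where \<mu> = "\<lambda>n. eigvals (truncation n)"
      and \<nu> = "\<lambda>\<theta>. eigvals (symbol \<theta>)" and a = "-pi" and b = pi and M = spectral_bound, OF _ r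
      _ _ size_eigvals[OF symbol_carrier] _ truncation_moments F]
    have t: "z \<in> \<real> \<and> norm z \<le> spectral_bound" if "z \<in># eigvals (truncation n)" for n z
      using eigvals_hermitian_real[OF truncation_carrier that truncation_hermitian]
        norm_eigvals_le_row_sum[OF truncation_carrier that truncation_row_sum] by blast
    have s: "z \<in> \<real> \<and> norm z \<le> spectral_bound" if "z \<in># eigvals (symbol \<theta>)" for \<theta> z
      using eigvals_hermitian_real[OF symbol_carrier that symbol_hermitian]
        norm_eigvals_le_row_sum[OF symbol_carrier that symbol_row_sum] by blast
    have c: "continuous_on {-pi..pi} (\<lambda>\<theta>. \<Sum>z\<in>#eigvals (symbol \<theta>). z ^ k)" for k
      unfolding power_sum_eigvals[OF symbol_carrier]
      by (intro continuous_on_sum continuous_symbol_pow) auto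
    have pi: "- pi < pi" by simp
    have cont: "continuous_on {-pi..pi} (\<lambda>\<theta>. (\<Sum>z\<in>#eigvals (symbol \<theta>). F z) / of_nat r)"
      by (rule *(1)[OF pi]) (fact t s c)+
    have dim: "dim_row (truncation n) = size (eigvals (truncation n))" for n
      unfolding size_eigvals[OF truncation_carrier] using truncation_carrier by blast
    have D: "measure lebesgue {-pi..pi} = pi - - pi" by simp
    show ?thesis
      unfolding set_lebesgue_integral_continuous[OF cont] dim D
      by (rule *(2)[OF pi]) (fact t s c)+
  qed
  then show ?thesis
    by (auto simp: spectral_symbol_def truncation_matrix_sequence symbol_matrix_function
      continuous_bounded_support_def)
qed

end

text \<open>
  A test function \<open>F\<close> for singular values is turned into the test function \<open>z \<mapsto> F \<bar>z\<bar>\<close> for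
  eigenvalues.
\<close>

lemma hermitian_spectral_imp_singular_value_symbol:
  assumes spec: "spectral_symbol A r D f"
    and hermA: "\<And>n i j. i < dim_row (A n) \<Longrightarrow> j < dim_row (A n) \<Longrightarrow> A n $$ (j, i) = cnj (A n $$ (i, j))"
    and sqA: "\<And>n. square_mat (A n)"
    and carr: "\<And>x. f x \<in> carrier_mat r r"
    and hermf: "\<And>x i j. i < r \<Longrightarrow> j < r \<Longrightarrow> f x $$ (j, i) = cnj (f x $$ (i, j))"
  shows "singular_value_symbol A r D f"
proof -
  have sA: "singvals (A n) = image_mset norm (eigvals (A n))" for n
    using sqA[of n] by (intro singvals_hermitian[of _ "dim_row (A n)"] hermA) auto
  have sf: "singvals (f x) = image_mset norm (eigvals (f x))" for x
    by (rule singvals_hermitian[OF carr]) (rule hermf)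
  have cbs: "continuous_bounded_support (\<lambda>z::complex. F (norm z))"
    if F: "continuous_bounded_support F" for F :: "real \<Rightarrow> complex"
  proof -
    from F obtain B where B: "\<And>x. F x \<noteq> 0 \<Longrightarrow> norm x \<le> B"
      unfolding continuous_bounded_support_def bounded_iff by auto
    have "bounded {z::complex. F (norm z) \<noteq> 0}"
      unfolding bounded_iff using B by fastforce
    moreover have "continuous_on UNIV (\<lambda>z::complex. F (norm z))"
      using F by (auto simp: continuous_bounded_support_def
        intro!: continuous_on_compose2[of UNIV F] continuous_intros)
    ultimately show ?thesis by (simp add: continuous_bounded_support_def)
  qed
  show ?thesis
    using spec cbs
    unfolding singular_value_symbol_def spectral_symbol_def sA sf multiset.map_comp o_def by blast
qed

section \<open>Assembly of the stiffness matrix\<close>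

lemma A_loc_commute: "A_loc r \<xi> i j = A_loc r \<xi> j i"
  by (simp add: A_loc_def mult.commute)

text \<open>
  Adjacent elements share exactly one node, so a node with \<open>a = 0\<close> is seen by two elements, as
  the first node of one and as the last node of the one before it.
\<close>

lemma node_in_element_iff:
  fixes a r :: nat
  assumes a: "a < r"
  shows "e * r \<le> m * r + a \<and> m * r + a \<le> e * r + r \<longleftrightarrow> e = m \<or> (a = 0 \<and> Suc e = m)" (is "?l \<longleftrightarrow> ?r")
proof
  assume l: ?l
  then have "e * r < Suc m * r" "m * r \<le> Suc e * r" using a by auto
  then have "e < Suc m" "m \<le> Suc e" using a by (simp_all only: mult_less_cancel2 mult_le_cancel2)
  then consider "e = m" | "m = Suc e" by linarith
  then show ?r using l by cases auto
qed (use a in auto)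

lemma assembled_entry_sum:
  assumes "p \<le> n * r" "q \<le> n * r"
  shows "assembled_matrix r \<xi> n $$ (p, q) = (\<Sum>e<n.
    if (e * r \<le> p \<and> p \<le> e * r + r) \<and> (e * r \<le> q \<and> q \<le> e * r + r)
    then A_loc r \<xi> (p - e * r + 1) (q - e * r + 1) else 0)"
proof -
  have elem: "(\<Sum>i\<in>{1..r+1}. \<Sum>j\<in>{1..r+1}.
      if LTG r i (Suc e) = p + 1 \<and> LTG r j (Suc e) = q + 1 then A_loc r \<xi> i j else 0) =
    (if (e * r \<le> p \<and> p \<le> e * r + r) \<and> (e * r \<le> q \<and> q \<le> e * r + r)
     then A_loc r \<xi> (p - e * r + 1) (q - e * r + 1) else 0)" (is "?lhs = ?rhs") for e
  proof -
    have "?lhs = (\<Sum>i\<in>{1..r+1}. \<Sum>j\<in>{1..r+1}.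
        if j = q + 1 - e * r then (if i = p + 1 - e * r then A_loc r \<xi> i j else 0) else 0)"
      by (intro sum.cong refl) (auto simp: LTG_def)
    also have "\<dots> = (\<Sum>i\<in>{1..r+1}. if i = p + 1 - e * r then
        (if q + 1 - e * r \<in> {1..r+1} then A_loc r \<xi> i (q + 1 - e * r) else 0) else 0)"
      by (intro sum.cong refl) (simp add: sum.delta)
    also have "\<dots> = (if p + 1 - e * r \<in> {1..r+1} then
        (if q + 1 - e * r \<in> {1..r+1} then A_loc r \<xi> (p + 1 - e * r) (q + 1 - e * r) else 0) else 0)"
      by (subst sum.delta) auto
    also have "\<dots> = ?rhs" by (auto simp: Suc_diff_le)
    finally show ?thesis .
  qed
  have "assembled_matrix r \<xi> n $$ (p, q) = (\<Sum>k\<in>{1..n}. \<Sum>i\<in>{1..r+1}. \<Sum>j\<in>{1..r+1}.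
      if LTG r i k = p + 1 \<and> LTG r j k = q + 1 then A_loc r \<xi> i j else 0)"
    using assms by (simp add: assembled_matrix_def del: sum.cl_ivl_Suc)
  also have "\<dots> = (\<Sum>e<n. \<Sum>i\<in>{1..r+1}. \<Sum>j\<in>{1..r+1}.
      if LTG r i (Suc e) = p + 1 \<and> LTG r j (Suc e) = q + 1 then A_loc r \<xi> i j else 0)"
    by (rule sum.reindex_bij_witness[of _ Suc "\<lambda>k. k - 1"]) auto
  finally show ?thesis unfolding elem .
qed

text \<open>
  For two nodes with the same quotient by \<open>r\<close> one element contributes, except on the diagonal at
  a shared node, where two contributions add up to the corner entry of the symbol. Since the
  first and last node are excluded, every shared node really has both neighbours.
  For quotients \<open>m\<close> and \<open>m + 1\<close> only element \<open>m\<close> contributes, and only if the second node is its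
  last one; hence the single nonzero row of \<open>beta_sym\<close>.
\<close>

lemma assembled_entry:
  assumes p: "1 \<le> p" "p < n * r" and q: "1 \<le> q" "q < n * r"
  shows "assembled_matrix r \<xi> n $$ (p, q) =
    (if p div r = q div r then alpha_sym r \<xi> $$ (p mod r, q mod r)
     else if p div r = Suc (q div r) then beta_sym r \<xi> $$ (p mod r, q mod r)
     else if q div r = Suc (p div r) then beta_sym r \<xi> $$ (q mod r, p mod r)
     else 0)"
proof -
  define I a J b where "I = p div r" and "a = p mod r" and "J = q div r" and "b = q mod r"
  have r: "0 < r" using p by (cases r) auto
  have ab: "a < r" "b < r" using r by (simp_all add: a_def b_def)
  have IJ: "I < n" "J < n" using p q by (simp_all add: I_def J_def less_mult_imp_div_less)
  have pq: "p = I * r + a" "q = J * r + b" by (simp_all add: I_def a_def J_def b_def)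
  let ?X = "\<lambda>e. A_loc r \<xi> (p - e * r + 1) (q - e * r + 1)"
  have sum: "assembled_matrix r \<xi> n $$ (p, q) = (\<Sum>e<n.
      if (e = I \<or> a = 0 \<and> Suc e = I) \<and> (e = J \<or> b = 0 \<and> Suc e = J) then ?X e else 0)"
    using assembled_entry_sum[of p n r q \<xi>] p q
    unfolding node_in_element_iff[OF ab(1), of _ I, folded pq] node_in_element_iff[OF ab(2), of _ J, folded pq]
    by simp
  have alpha: "alpha_sym r \<xi> $$ (a, b) = A_loc r \<xi> (a + 1) (b + 1) +
      (if a = 0 \<and> b = 0 then A_loc r \<xi> (r + 1) (r + 1) else 0)"
    using ab by (simp add: alpha_sym_def A_sym_def)
  have beta: "beta_sym r \<xi> $$ (c, d) = (if c = 0 then A_loc r \<xi> (r + 1) (d + 1) else 0)"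
    if "c < r" "d < r" for c d
    using that by (simp add: beta_sym_def A_sym_def)
  have "(\<Sum>e<n. if (e = I \<or> a = 0 \<and> Suc e = I) \<and> (e = J \<or> b = 0 \<and> Suc e = J) then ?X e else 0) =
    (if I = J then alpha_sym r \<xi> $$ (a, b)
     else if I = Suc J then beta_sym r \<xi> $$ (a, b)
     else if J = Suc I then beta_sym r \<xi> $$ (b, a)
     else 0)" (is "?s = _")
  proof -
    consider "I = J" | "I = Suc J" | "J = Suc I" | "I \<noteq> J" "I \<noteq> Suc J" "J \<noteq> Suc I" by blast
    then show ?thesis
    proof cases
      case 1
      have "?s = (\<Sum>e<n. (if e = I then ?X I else 0) +
          (if e = I - 1 then if a = 0 \<and> b = 0 then A_loc r \<xi> (r + 1) (r + 1) else 0 else 0))"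
      proof (rule sum.cong)
        fix e
        have I0: "I \<noteq> 0" if "a = 0" using p(1) that pq(1) by (cases I) auto
        have step: "J * r - (J - Suc 0) * r = r" if "0 < J" using that by (cases J) auto
        show "(if (e = I \<or> a = 0 \<and> Suc e = I) \<and> (e = J \<or> b = 0 \<and> Suc e = J) then ?X e else 0) =
          (if e = I then ?X I else 0) +
          (if e = I - 1 then if a = 0 \<and> b = 0 then A_loc r \<xi> (r + 1) (r + 1) else 0 else 0)"
          using 1 I0 pq by (auto simp: step)
      qed simp
      also have "\<dots> = ?X I + (if a = 0 \<and> b = 0 then A_loc r \<xi> (r + 1) (r + 1) else 0)"
        unfolding sum.distrib using IJ by simp
      finally show ?thesis using 1 pq alpha by simp
    next
      case 2
      have "?s = (\<Sum>e<n. if e = J then (if a = 0 then ?X J else 0) else 0)"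
        by (rule sum.cong) (use 2 in auto)
      also have "\<dots> = (if a = 0 then A_loc r \<xi> (r + 1) (b + 1) else 0)"
        using IJ 2 pq by simp
      finally show ?thesis using 2 beta[OF ab] by simp
    next
      case 3
      have "?s = (\<Sum>e<n. if e = I then (if b = 0 then ?X I else 0) else 0)"
        by (rule sum.cong) (use 3 in auto)
      also have "\<dots> = (if b = 0 then A_loc r \<xi> (a + 1) (r + 1) else 0)"
        using IJ 3 pq by simp
      finally show ?thesis using 3 beta[OF ab(2,1)] by (simp add: A_loc_commute)
    next
      case 4
      then have "?s = 0" by (intro sum.neutral) auto
      with 4 show ?thesis by simp
    qed
  qed
  then show ?thesis unfolding sum by (simp only: I_def a_def J_def b_def)
qed

lemma stiffness_matrix_carrier:
  "stiffness_matrix r \<xi> n \<in> carrier_mat (n * r - 1) (n * r - 1)"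
  by (simp add: stiffness_matrix_def assembled_matrix_def mat_delete_def)

lemma stiffness_matrix_index:
  assumes "p < n * r - 1" "q < n * r - 1"
  shows "stiffness_matrix r \<xi> n $$ (p, q) = complex_of_real (assembled_matrix r \<xi> n $$ (Suc p, Suc q))"
proof -
  have "dim_row (assembled_matrix r \<xi> n) = n * r + 1" "dim_col (assembled_matrix r \<xi> n) = n * r + 1"
    by (simp_all add: assembled_matrix_def)
  moreover have "Suc p < n * r" "Suc q < n * r" using assms by auto
  ultimately show ?thesis
    using assms by (simp add: stiffness_matrix_def mat_delete_def)
qed

lemma pick_atLeastLessThan:
  assumes "i < N - 1" shows "pick {1..<N} i = Suc i"
proof -
  have "{a \<in> {1..<N}. a < Suc i} = {1..<Suc i}" using assms by auto
  then have "card {a \<in> {1..<N}. a < Suc i} = i" by simp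
  with pick_card_in_set[of "Suc i" "{1..<N}"] assms show ?thesis by simp
qed

section \<open>The spectral and singular value symbol\<close>

theorem mainTheorem2:
  fixes r :: nat and \<xi> :: "nat \<Rightarrow> real"
  assumes "1 \<le> r"
    and "inj_on \<xi> {1..r+1}"
    and "\<xi> ` {1..r+1} \<subseteq> {0..1}"
    and "\<xi> 1 = 0"
    and "\<xi> (r + 1) = 1"
  shows "(\<forall>n\<ge>1. stiffness_matrix r \<xi> n \<in> carrier_mat (n * r - 1) (n * r - 1) \<and>
            principal_submatrix (stiffness_matrix r \<xi> n) (block_toeplitz r n (fem_symbol r \<xi>)))
       \<and> singular_value_symbol (stiffness_matrix r \<xi>) r {-pi..pi} (fem_symbol r \<xi>)
       \<and> spectral_symbol (stiffness_matrix r \<xi>) r {-pi..pi} (fem_symbol r \<xi>)"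
proof -
  let ?A0 = "map_mat complex_of_real (alpha_sym r \<xi>)"
  let ?A1 = "map_mat complex_of_real (beta_sym r \<xi>)"
  let ?A2 = "map_mat complex_of_real (transpose_mat (beta_sym r \<xi>))"
  have r: "0 < r" using assms(1) by simp
  interpret tridiagonal_symbol r ?A0 ?A1 ?A2
  proof
    fix i j assume ij: "i < r" "j < r"
    show "?A0 $$ (j, i) = cnj (?A0 $$ (i, j))"
      using ij by (simp add: alpha_sym_def A_sym_def A_loc_commute)
    show "?A2 $$ (j, i) = cnj (?A1 $$ (i, j))"
      using ij by (simp add: beta_sym_def)
  qed (use r in \<open>auto simp: alpha_sym_def beta_sym_def\<close>)
  have symbol: "fem_symbol r \<xi> = symbol"
    by (rule ext) (simp add: fem_symbol_def symbol_def)
  have toeplitz: "block_toeplitz r n (fem_symbol r \<xi>) $$ (p, q) = laurent 1 (int p) (int q)"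
    if "p < n * r" "q < n * r" for n p q
    using that by (simp add: block_toeplitz_def laurent_def pow_coeff_def symbol zdiv_int nat_mod_distrib
      flip: of_nat_mod)
  have entry: "stiffness_matrix r \<xi> n $$ (p, q) = laurent 1 (int (Suc p)) (int (Suc q))"
    if pq: "p < n * r - 1" "q < n * r - 1" for n p q
  proof -
    have dims: "alpha_sym r \<xi> \<in> carrier_mat r r" "beta_sym r \<xi> \<in> carrier_mat r r"
      by (simp_all add: alpha_sym_def beta_sym_def)
    have nm: "nat (int m mod int r) = m mod r" for m by (simp flip: of_nat_mod)
    show ?thesis
      unfolding stiffness_matrix_index[OF pq] laurent_def pow_coeff_1[OF nat_mod_less nat_mod_less]
      unfolding nm zdiv_int[symmetric]
      by (subst assembled_entry) (use pq dims r in \<open>auto simp del: of_nat_Suc\<close>)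
  qed
  have trunc: "stiffness_matrix r \<xi> = truncation"
  proof
    fix n
    show "stiffness_matrix r \<xi> n = truncation n"
      using stiffness_matrix_carrier[of r \<xi> n] truncation_carrier[of n]
      by (intro eq_matI) (auto simp: entry truncation_index simp del: of_nat_Suc)
  qed
  have principal: "principal_submatrix (stiffness_matrix r \<xi> n) (block_toeplitz r n (fem_symbol r \<xi>))" for n
  proof -
    let ?T = "block_toeplitz r n (fem_symbol r \<xi>)" and ?I = "{1..<n * r}"
    have dim: "dim_row ?T = n * r" "dim_col ?T = n * r" by (simp_all add: block_toeplitz_def)
    have I: "{i. i < n * r \<and> i \<in> ?I} = ?I" by auto
    have "stiffness_matrix r \<xi> n = submatrix ?T ?I ?I"
      unfolding submatrix_def dim I
    proof (rule eq_matI)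
      fix i j assume "i < dim_row (mat (card ?I) (card ?I) (\<lambda>(i, j). ?T $$ (pick ?I i, pick ?I j)))"
        and "j < dim_col (mat (card ?I) (card ?I) (\<lambda>(i, j). ?T $$ (pick ?I i, pick ?I j)))"
      then have ij: "i < n * r - 1" "j < n * r - 1" by simp_all
      then have "?T $$ (pick ?I i, pick ?I j) = laurent 1 (int (Suc i)) (int (Suc j))"
        unfolding pick_atLeastLessThan[OF ij(1)] pick_atLeastLessThan[OF ij(2)]
        by (intro toeplitz) linarith+
      then show "stiffness_matrix r \<xi> n $$ (i, j) =
          mat (card ?I) (card ?I) (\<lambda>(i, j). ?T $$ (pick ?I i, pick ?I j)) $$ (i, j)"
        unfolding entry[OF ij] using ij by simp
    qed (use stiffness_matrix_carrier[of r \<xi> n] in auto)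
    then show ?thesis
      unfolding principal_submatrix_def using dim by (intro conjI exI[of _ ?I]) auto
  qed
  have "spectral_symbol (stiffness_matrix r \<xi>) r {-pi..pi} (fem_symbol r \<xi>)"
    unfolding trunc symbol by (rule truncation_spectral_symbol)
  moreover from this have "singular_value_symbol (stiffness_matrix r \<xi>) r {-pi..pi} (fem_symbol r \<xi>)"
    unfolding trunc symbol
  proof (rule hermitian_spectral_imp_singular_value_symbol)
    fix n i j
    have dim: "dim_row (truncation n) = n * r - 1" "dim_col (truncation n) = n * r - 1"
      using truncation_carrier[of n] by blast+
    show "truncation n $$ (j, i) = cnj (truncation n $$ (i, j))"
      if "i < dim_row (truncation n)" "j < dim_row (truncation n)"
      using truncation_hermitian that unfolding dim by blast
    show "square_mat (truncation n)" by (simp only: dim square_mat.simps)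
  qed (fact symbol_carrier, rule symbol_hermitian)
  ultimately show ?thesis using stiffness_matrix_carrier principal by blast
qed

end
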